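(* Let $\mathbb{X}$ be a finite-dimensional Euclidean space, let $f:\mathbb{X}\to\mathbb{R}$ be a twice continuously differentiable convex function, let $g:\mathbb{X}\to\mathbb{R}\cup\{+\infty\}$ be a proper convex polyhedral function, and put $\varphi:=f+g$. Suppose that $\bar x$ is a tilt stable minimizer of $\varphi$, i.e., $-\nabla f(\bar x)\in\partial g(\bar x)$ and $\operatorname{Ker}\nabla^2 f(\bar x)\cap \operatorname{par}\partial g^*(-\nabla f(\bar x))=\{0\}$, and that $\nabla^2 f$ is Lipschitz continuous around $\bar x$. Let $\alpha>0$ and let $\{\beta_k\}\subset(0,1]$ be a sequence bounded below in $(0,1]$. Then there exist $\varepsilon>0$ and $\widetilde C>0$ (with $\widetilde C$ independent of $\varepsilon$) such that for each starting point $x_0$ with $\|x_0-\bar x\|\le\varepsilon$, the FISTA-Newton method with effective subspaces (described in the context) with parameters $\alpha$ and $\{\beta_k\}$ produces a sequence $\{x_k\}$ for which $$p_k:=\max\{\|x_k-\bar x\|,\ \|x_{k-1}-\bar x\|\},\qquad k\in\mathbb{N}\cup\{0\},$$ satisfies (i) $p_0,p_1\le\varepsilon$; (ii) $p_{k+2}\le\widetilde C\,p_k^2$ for all $k\in\mathbb{N}\cup\{0\}$.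
   Context: Notation. $\partial g$ is the convex subdifferential of $g$, and $g^*(v)=\sup_{x}\{\langle v,x\rangle-g(x)\}$ is the Legendre–Fenchel conjugate. A proper function $g$ is convex polyhedral if its epigraph is the intersection of finitely many closed half-spaces in $\mathbb{X}\times\mathbb{R}$. For a nonempty convex set $C$, $\operatorname{par}C:=\operatorname{span}(C-x)$ for any $x\in C$. The proximal operator is $\operatorname{prox}_{\alpha g}(x):=\operatorname{argmin}_{y}\{g(y)+\frac1{2\alpha}\|y-x\|^2\}$. Tilt stability. A point $\bar x\in\operatorname{dom}\varphi$ is a tilt stable minimizer of a lower semicontinuous convex function $\varphi$ if there is $\gamma>0$ such that $M_\gamma(v):=\operatorname{argmin}\{\varphi(x)-\langle v,x\rangle\mid \|x-\bar x\|\le\gamma\}$ is single-valued and Lipschitz continuous on some neighborhood of $0\in\mathbb{X}$ with $M_\gamma(0)=\{\bar x\}$. For $\varphi=f+g$ as here this is known to be equivalent to the two conditions given after "i.e." in the claim. FISTA-Newton method with effective subspaces. Input: $x_0=x_{-1}\in\mathbb{X}$, $\alpha>0$, $\{\beta_k\}\subset(0,1]$. For $k=0,1,2,\dots$: (1) $u_k:=x_k+\beta_k(x_k-x_{k-1})$; (2) $y_k:=\operatorname{prox}_{\alpha g}(u_k-\alpha\nabla f(u_k))$; (3) $z_k:=\frac{u_k-y_k}{\alpha}-\nabla f(u_k)$; (4) $L_k:=\operatorname{par}\partial g^*(z_k)$, and $d_k$ is an optimal solution of $\min_{d\in L_k}\frac12\langle\nabla^2 f(y_k)d,d\rangle-\langle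 z_k+\nabla f(y_k),d\rangle$; (5) $x_{k+1}=y_k-d_k$. The sequence $\{\beta_k\}$ being bounded below in $(0,1]$ means $\beta_k\ge\beta$ for all $k$ for some $\beta>0$. *)

theory Defs
  imports "HOL-Analysis.Analysis"
begin

definition argmin_on :: "('a \<Rightarrow> 'b::order) \<Rightarrow> 'a set \<Rightarrow> 'a set"
  where "argmin_on h S = {x. is_arg_min h (\<lambda>x. x \<in> S) x}"

definition proper :: "('a \<Rightarrow> ereal) \<Rightarrow> bool"
  where "proper g \<longleftrightarrow> (\<forall>x. g x \<noteq> -\<infinity>) \<and> (\<exists>x. g x \<noteq> \<infinity>)"

definition epi :: "('a \<Rightarrow> ereal) \<Rightarrow> ('a \<times> real) set"
  where "epi g = {(x, r). g x \<le> ereal r}"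

definition convex_polyhedral :: "('a::euclidean_space \<Rightarrow> ereal) \<Rightarrow> bool"
  where "convex_polyhedral g \<longleftrightarrow> polyhedron (epi g)"

text \<open>The subdifferential is empty at points where the function is not finite.\<close>

definition subdifferential :: "('a::real_inner \<Rightarrow> ereal) \<Rightarrow> 'a \<Rightarrow> 'a set"
  where "subdifferential g x =
    {v. \<bar>g x\<bar> \<noteq> \<infinity> \<and> (\<forall>y. g x + ereal (v \<bullet> (y - x)) \<le> g y)}"

definition conjugate :: "('a::real_inner \<Rightarrow> ereal) \<Rightarrow> 'a \<Rightarrow> ereal"
  where "conjugate g v = (SUP x. ereal (v \<bullet> x) - g x)"

definition par :: "'a::real_vector set \<Rightarrow> 'a set"
  where "par C = span ((\<lambda>y. y - (SOME x. x \<in> C)) ` C)"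

text \<open>The choice of base point is immaterial.\<close>

lemma par_eq_span:
  assumes "x \<in> C"
  shows "par C = span ((\<lambda>y. y - x) ` C)"
proof -
  have sub: "span ((\<lambda>y. y - a) ` C) \<subseteq> span ((\<lambda>y. y - b) ` C)"
    if "a \<in> C" "b \<in> C" for a b
  proof (rule span_minimal)
    show "(\<lambda>y. y - a) ` C \<subseteq> span ((\<lambda>y. y - b) ` C)"
    proof
      fix w assume "w \<in> (\<lambda>y. y - a) ` C"
      then obtain y where y: "y \<in> C" "w = (y - b) - (a - b)" by auto
      then show "w \<in> span ((\<lambda>y. y - b) ` C)"
        using that by (metis imageI span_base span_diff)
    qed
  qed simp
  have "(SOME x. x \<in> C) \<in> C" using assms by (rule someI)
  then show ?thesis
    unfolding par_def using sub assms by (meson subset_antisym)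
qed

text \<open>The proximal operator is given by its argmin set, which is a singleton when
  \<open>g\<close> is proper, lower semicontinuous and convex and \<open>\<alpha> > 0\<close>.\<close>

definition prox :: "real \<Rightarrow> ('a::real_inner \<Rightarrow> ereal) \<Rightarrow> 'a \<Rightarrow> 'a set"
  where "prox \<alpha> g x = argmin_on (\<lambda>y. g y + ereal (1 / (2 * \<alpha>) * (norm (y - x))\<^sup>2)) UNIV"

definition tilt_argmin :: "('a::real_inner \<Rightarrow> ereal) \<Rightarrow> 'a \<Rightarrow> real \<Rightarrow> 'a \<Rightarrow> 'a set"
  where "tilt_argmin \<phi> xbar \<gamma> v = argmin_on (\<lambda>x. \<phi> x - ereal (v \<bullet> x)) (cball xbar \<gamma>)"

definition tilt_stable_minimizer :: "('a::real_inner \<Rightarrow> ereal) \<Rightarrow> 'a \<Rightarrow> bool"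
  where "tilt_stable_minimizer \<phi> xbar \<longleftrightarrow>
    \<phi> xbar \<noteq> \<infinity> \<and>
    (\<exists>\<gamma>>0. tilt_argmin \<phi> xbar \<gamma> 0 = {xbar} \<and>
      (\<exists>U m K. open U \<and> 0 \<in> U \<and> (\<forall>v\<in>U. tilt_argmin \<phi> xbar \<gamma> v = {m v}) \<and>
        K-lipschitz_on U m))"

text \<open>The predecessor \<open>x\<^sub>k\<^sub>-\<^sub>1\<close>, with the convention that index \<open>-1\<close> repeats \<open>x\<^sub>0\<close>.\<close>

definition prev :: "(nat \<Rightarrow> 'a) \<Rightarrow> nat \<Rightarrow> 'a"
  where "prev x k = (case k of 0 \<Rightarrow> x 0 | Suc j \<Rightarrow> x j)"

text \<open>One iteration, as a relation between \<open>x\<^sub>k\<^sub>-\<^sub>1\<close>, \<open>x\<^sub>k\<close> and \<open>x\<^sub>k\<^sub>+\<^sub>1\<close>: the quadratic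
  subproblem may have no solution or several, and any solution may be taken.
  \<open>Df\<close> and \<open>D2f\<close> are the gradient and the Hessian of \<open>f\<close>.\<close>

definition fista_newton_step ::
  "('a::real_inner \<Rightarrow> 'a) \<Rightarrow> ('a \<Rightarrow> 'a \<Rightarrow>\<^sub>L 'a) \<Rightarrow> ('a \<Rightarrow> ereal) \<Rightarrow> real \<Rightarrow> real \<Rightarrow>
    'a \<Rightarrow> 'a \<Rightarrow> 'a \<Rightarrow> bool"
  where "fista_newton_step Df D2f g \<alpha> b xprev xcur xnext \<longleftrightarrow>
    (\<exists>u y z d.
      u = xcur + b *\<^sub>R (xcur - xprev) \<and>
      y \<in> prox \<alpha> g (u - \<alpha> *\<^sub>R Df u) \<and>
      z = (1 / \<alpha>) *\<^sub>R (u - y) - Df u \<and>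
      d \<in> argmin_on (\<lambda>d. 1 / 2 * (blinfun_apply (D2f y) d \<bullet> d) - (z + Df y) \<bullet> d)
            (par (subdifferential (conjugate g) z)) \<and>
      xnext = y - d)"

definition fista_newton_sequence ::
  "('a::real_inner \<Rightarrow> 'a) \<Rightarrow> ('a \<Rightarrow> 'a \<Rightarrow>\<^sub>L 'a) \<Rightarrow> ('a \<Rightarrow> ereal) \<Rightarrow> real \<Rightarrow> (nat \<Rightarrow> real) \<Rightarrow>
    'a \<Rightarrow> (nat \<Rightarrow> 'a) \<Rightarrow> bool"
  where "fista_newton_sequence Df D2f g \<alpha> \<beta> x0 x \<longleftrightarrow>
    x 0 = x0 \<and>
    (\<forall>k. fista_newton_step Df D2f g \<alpha> (\<beta> k) (prev x k) (x k) (x (Suc k)))"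

definition pair_error :: "'a::real_normed_vector \<Rightarrow> (nat \<Rightarrow> 'a) \<Rightarrow> nat \<Rightarrow> real"
  where "pair_error xbar x k = max (norm (x k - xbar)) (norm (prev x k - xbar))"

end

theory Submission
  imports Defs
begin

text \<open>Write \<open>zbar = - Df xbar\<close> and \<open>A z\<close> for the set of points at which \<open>z\<close> is a subgradient of \<open>g\<close>.
  For closed convex \<open>g\<close> this set is the subdifferential of the conjugate at \<open>z\<close>
  (\<open>subdifferential_conjugate\<close>), and the effective subspace of an iteration is the linear span \<open>L\<close>
  of the differences of elements of \<open>A z\<close>. The proximal step produces \<open>y\<close> close to \<open>xbar\<close> and \<open>z\<close>
  close to \<open>zbar\<close> with \<open>y \<in> A z\<close>, both errors being of the order of the error of the
  extrapolated point, because \<open>Df\<close> is differentiable at \<open>xbar\<close>, the resolvent is nonexpansive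
  and \<open>xbar\<close> is a fixed point.

  Beyond closedness and convexity of the epigraph, polyhedrality enters only through the fact
  that there are finitely many sets \<open>A z\<close>: each
  nonempty one is the projection of an exposed face of the epigraph
  (\<open>finite_range_subdifferential_conjugate\<close>). Since the subdifferentials of \<open>g\<close> and of its
  conjugate are closed, finiteness gives two local inclusions: \<open>A z \<subseteq> A zbar\<close> for \<open>z\<close> near \<open>zbar\<close>,
  and \<open>xbar \<in> A z\<close> as soon as \<open>A z\<close> contains a point near \<open>xbar\<close>. Consequently \<open>y - xbar\<close> lies
  in \<open>L\<close>, \<open>L\<close> is contained in the span \<open>Lbar\<close> of the differences of \<open>A zbar\<close>, and, by monotonicity
  of the subdifferential, \<open>z - zbar\<close> is orthogonal to \<open>L\<close>.

  Tilt stability makes the Hessian at \<open>xbar\<close> positive definite on \<open>Lbar\<close>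
  (\<open>tilt_stable_hessian_coercive\<close>): a point \<open>x\<close> of \<open>A zbar\<close> near \<open>xbar\<close> minimizes the problem
  tilted by \<open>Df x - Df xbar\<close>, so that \<open>norm (x - y) \<le> K * norm (Df x - Df y)\<close> for two such points,
  and differentiating at relative interior points of \<open>A zbar\<close> that tend to \<open>xbar\<close> gives
  \<open>norm d \<le> K * norm (D2f xbar d)\<close> for \<open>d\<close> in \<open>Lbar\<close>.

  The subproblem of an iteration therefore has a solution \<open>d\<close>, and its normal equation, tested with
  the new error \<open>y - d - xbar \<in> L\<close>, bounds this error by the linearization error
  of \<open>Df\<close> at \<open>y\<close>, which is quadratic in \<open>norm (y - xbar)\<close> by the Lipschitz condition on the Hessian
  (\<open>fista_newton_step_quadratic\<close>). Near \<open>xbar\<close> the quadratic estimate keeps the errors from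
  increasing, and two consecutive iterations give the estimate for the maximum of two errors.\<close>

section \<open>Gradients and Hessians\<close>

lemma GDERIV_along_line:
  assumes "GDERIV f (x + t *\<^sub>R v) :> d"
  shows "((\<lambda>s. f (x + s *\<^sub>R v)) has_real_derivative v \<bullet> d) (at t)"
proof -
  have "((\<lambda>s. x + s *\<^sub>R v) has_derivative (\<lambda>s. s *\<^sub>R v)) (at t)"
    by (auto intro!: derivative_eq_intros)
  moreover have "(f has_derivative (\<lambda>h. h \<bullet> d)) (at (x + t *\<^sub>R v))"
    using assms by (simp add: gderiv_def)
  ultimately have "((\<lambda>s. f (x + s *\<^sub>R v)) has_derivative (\<lambda>s. (s *\<^sub>R v) \<bullet> d)) (at t)"
    by (rule has_derivative_compose)
  then show ?thesis
    by (simp add: has_field_derivative_def mult_commute_abs)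
qed

lemma has_derivative_inner_along_line:
  fixes F :: "'a::real_inner \<Rightarrow> 'a"
  assumes "(F has_derivative F') (at (x + t *\<^sub>R v))"
  shows "((\<lambda>s. F (x + s *\<^sub>R v) \<bullet> w) has_real_derivative F' v \<bullet> w) (at t)"
proof -
  have "((\<lambda>s. x + s *\<^sub>R v) has_derivative (\<lambda>s. s *\<^sub>R v)) (at t)"
    by (auto intro!: derivative_eq_intros)
  then have "((\<lambda>s. F (x + s *\<^sub>R v)) has_derivative (\<lambda>s. F' (s *\<^sub>R v))) (at t)"
    using assms by (rule has_derivative_compose)
  then have "((\<lambda>s. F (x + s *\<^sub>R v) \<bullet> w) has_derivative (\<lambda>s. F' (s *\<^sub>R v) \<bullet> w)) (at t)"
    by (rule has_derivative_inner_left)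
  moreover have "F' (s *\<^sub>R v) = s *\<^sub>R F' v" for s
    using assms has_derivative_linear linear_cmul by blast
  ultimately show ?thesis
    by (simp add: has_field_derivative_def mult_commute_abs)
qed

lemma convex_gradient_inequality:
  fixes f :: "'a::real_inner \<Rightarrow> real"
  assumes "convex_on UNIV f" and "GDERIV f x :> d"
  shows "f x + d \<bullet> (y - x) \<le> f y"
proof -
  let ?p = "\<lambda>t. f (x + t *\<^sub>R (y - x))"
  have "convex_on UNIV ?p"
  proof (rule convex_onI)
    fix t a b :: real assume t: "0 < t" "t < 1"
    have "x + ((1 - t) *\<^sub>R a + t *\<^sub>R b) *\<^sub>R (y - x)
        = (1 - t) *\<^sub>R (x + a *\<^sub>R (y - x)) + t *\<^sub>R (x + b *\<^sub>R (y - x))"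
      by (simp add: algebra_simps)
    then show "?p ((1 - t) *\<^sub>R a + t *\<^sub>R b) \<le> (1 - t) * ?p a + t * ?p b"
      using convex_onD[OF assms(1), of t "x + a *\<^sub>R (y - x)" "x + b *\<^sub>R (y - x)"] t by simp
  qed simp
  moreover have "(?p has_real_derivative (y - x) \<bullet> d) (at 0)"
    using assms(2) by (intro GDERIV_along_line) simp
  ultimately have "?p 1 - ?p 0 \<ge> ((y - x) \<bullet> d) * (1 - 0)"
    by (intro convex_on_imp_above_tangent[where A = UNIV]) auto
  then show ?thesis by (simp add: inner_commute algebra_simps)
qed

lemma convex_hessian_nonneg:
  fixes f :: "'a::real_inner \<Rightarrow> real"
  assumes "convex_on UNIV f" and grad: "\<And>x. GDERIV f x :> Df x"
    and "(Df has_derivative H) (at x)"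
  shows "0 \<le> H w \<bullet> w"
proof -
  let ?p = "\<lambda>s. Df (x + s *\<^sub>R w) \<bullet> w"
  have "mono_on UNIV ?p"
  proof (rule mono_onI)
    fix a b :: real assume "a \<le> b"
    have "Df (x + a *\<^sub>R w) \<bullet> ((b - a) *\<^sub>R w) \<le> Df (x + b *\<^sub>R w) \<bullet> ((b - a) *\<^sub>R w)"
      using convex_gradient_inequality[OF assms(1) grad, of "x + a *\<^sub>R w" "x + b *\<^sub>R w"]
        convex_gradient_inequality[OF assms(1) grad, of "x + b *\<^sub>R w" "x + a *\<^sub>R w"]
      by (simp add: algebra_simps)
    then have "(b - a) * ?p a \<le> (b - a) * ?p b" by simp
    then show "?p a \<le> ?p b"
      using \<open>a \<le> b\<close> by (cases "a = b") auto
  qed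
  moreover have "(?p has_real_derivative H w \<bullet> w) (at 0)"
    using assms(3) by (intro has_derivative_inner_along_line) simp
  ultimately show ?thesis
    by (rule mono_on_imp_deriv_nonneg) auto
qed

text \<open>Two applications of the mean value theorem write the second difference of \<open>f\<close> over a
  parallelogram with sides \<open>t a\<close> and \<open>t b\<close> as \<open>t\<^sup>2\<close> times a value of the bilinear form of the
  Hessian; the second difference is symmetric in \<open>a\<close> and \<open>b\<close>.\<close>

lemma second_difference_mean_value:
  fixes f :: "'a::real_inner \<Rightarrow> real"
  assumes grad: "\<And>x. GDERIV f x :> Df x" and hess: "\<And>x. (Df has_derivative H x) (at x)"
    and t: "0 < t"
  obtains \<xi> where "norm (\<xi> - x) \<le> t * (norm a + norm b)"
    and "f (x + t *\<^sub>R a + t *\<^sub>R b) - f (x + t *\<^sub>R a) - f (x + t *\<^sub>R b) + f x = t\<^sup>2 * (H \<xi> b \<bullet> a)"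
proof -
  let ?p = "\<lambda>s. f (x + t *\<^sub>R b + s *\<^sub>R a) - f (x + s *\<^sub>R a)"
  have "(?p has_real_derivative (a \<bullet> Df (x + t *\<^sub>R b + s *\<^sub>R a) - a \<bullet> Df (x + s *\<^sub>R a))) (at s)" for s
    by (intro DERIV_diff GDERIV_along_line grad)
  then obtain s where s: "0 < s" "s < t"
    and 1: "?p t - ?p 0 = (t - 0) * (a \<bullet> Df (x + t *\<^sub>R b + s *\<^sub>R a) - a \<bullet> Df (x + s *\<^sub>R a))"
    using MVT2[OF t, of ?p "\<lambda>s. a \<bullet> Df (x + t *\<^sub>R b + s *\<^sub>R a) - a \<bullet> Df (x + s *\<^sub>R a)"]
    by blast
  let ?q = "\<lambda>r. Df (x + s *\<^sub>R a + r *\<^sub>R b) \<bullet> a"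
  have "(?q has_real_derivative H (x + s *\<^sub>R a + r *\<^sub>R b) b \<bullet> a) (at r)" for r
    by (intro has_derivative_inner_along_line hess)
  then obtain r where r: "0 < r" "r < t"
    and 2: "?q t - ?q 0 = (t - 0) * (H (x + s *\<^sub>R a + r *\<^sub>R b) b \<bullet> a)"
    using MVT2[OF t, of ?q "\<lambda>r. H (x + s *\<^sub>R a + r *\<^sub>R b) b \<bullet> a"] by blast
  show ?thesis
  proof
    have "norm (s *\<^sub>R a + r *\<^sub>R b) \<le> s * norm a + r * norm b"
      using s r by (metis abs_of_pos norm_scaleR norm_triangle_ineq)
    also have "\<dots> \<le> t * norm a + t * norm b"
      using s r by (intro add_mono mult_right_mono) auto
    finally show "norm ((x + s *\<^sub>R a + r *\<^sub>R b) - x) \<le> t * (norm a + norm b)"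
      by (simp add: algebra_simps)
    have "f (x + t *\<^sub>R a + t *\<^sub>R b) - f (x + t *\<^sub>R a) - f (x + t *\<^sub>R b) + f x = ?p t - ?p 0"
      by (simp add: algebra_simps)
    also have "\<dots> = t * (?q t - ?q 0)"
      unfolding 1 by (simp add: algebra_simps inner_commute)
    finally show "f (x + t *\<^sub>R a + t *\<^sub>R b) - f (x + t *\<^sub>R a) - f (x + t *\<^sub>R b) + f x
        = t\<^sup>2 * (H (x + s *\<^sub>R a + r *\<^sub>R b) b \<bullet> a)"
      unfolding 2 by (simp add: power2_eq_square)
  qed
qed

lemma hessian_symmetric:
  fixes f :: "'a::real_inner \<Rightarrow> real"
  assumes grad: "\<And>x. GDERIV f x :> Df x"
    and hess: "\<And>x. (Df has_derivative blinfun_apply (D2f x)) (at x)"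
    and cont: "continuous_on UNIV D2f"
  shows "blinfun_apply (D2f x) a \<bullet> b = a \<bullet> blinfun_apply (D2f x) b"
proof -
  define S where "S t a b = f (x + t *\<^sub>R a + t *\<^sub>R b) - f (x + t *\<^sub>R a) - f (x + t *\<^sub>R b) + f x"
    for t :: real and a b :: 'a
  let ?t = "\<lambda>n. inverse (real (Suc n))"
  have lim: "(\<lambda>n. S (?t n) a b / (?t n)\<^sup>2) \<longlonglongrightarrow> blinfun_apply (D2f x) b \<bullet> a" for a b
  proof -
    have "\<exists>\<xi>. norm (\<xi> - x) \<le> ?t n * (norm a + norm b) \<and> S (?t n) a b = (?t n)\<^sup>2 * (D2f \<xi> b \<bullet> a)" for n
      unfolding S_def
      using second_difference_mean_value[OF grad hess, of "?t n" x a b thesis for thesis]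
      by (metis inverse_positive_iff_positive of_nat_0_less_iff zero_less_Suc)
    then obtain \<xi> where \<xi>: "\<And>n. norm (\<xi> n - x) \<le> ?t n * (norm a + norm b)"
      "\<And>n. S (?t n) a b = (?t n)\<^sup>2 * (D2f (\<xi> n) b \<bullet> a)" by metis
    have "(\<lambda>n. ?t n * (norm a + norm b)) \<longlonglongrightarrow> 0"
      using LIMSEQ_inverse_real_of_nat by (rule tendsto_mult_left_zero)
    then have "(\<lambda>n. \<xi> n - x) \<longlonglongrightarrow> 0"
      by (rule Lim_null_comparison[rotated]) (rule always_eventually[OF allI[OF \<xi>(1)]])
    then have "\<xi> \<longlonglongrightarrow> x" by (simp add: LIM_zero_iff)
    then have "(\<lambda>n. D2f (\<xi> n)) \<longlonglongrightarrow> D2f x"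
      using cont by (auto simp: continuous_on_eq_continuous_at isCont_tendsto_compose)
    then have "(\<lambda>n. D2f (\<xi> n) b \<bullet> a) \<longlonglongrightarrow> D2f x b \<bullet> a"
      by (intro tendsto_intros)
    then show ?thesis by (simp add: \<xi>(2) del: of_nat_Suc)
  qed
  have "S t a b = S t b a" for t by (simp add: S_def algebra_simps)
  then show ?thesis
    using LIMSEQ_unique[OF lim[of a b]] lim[of b a] by (simp add: inner_commute)
qed

text \<open>Quantitative form of: a vector isotropic for a positive semidefinite form lies in its kernel.\<close>

lemma psd_norm_le:
  fixes H :: "'a::real_inner \<Rightarrow>\<^sub>L 'a"
  assumes sym: "\<And>a b. H a \<bullet> b = a \<bullet> H b" and psd: "\<And>w. 0 \<le> H w \<bullet> w"
  shows "(norm (H d))\<^sup>2 \<le> (norm H + 1) * (H d \<bullet> d)"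
proof -
  define M where "M = norm H + 1"
  have M: "M > 0" unfolding M_def by (simp add: add_nonneg_pos)
  define e where "e = H d"
  have "H e \<bullet> e \<le> M * (norm e)\<^sup>2"
  proof -
    have "H e \<bullet> e \<le> norm (H e) * norm e" by (rule norm_cauchy_schwarz)
    also have "\<dots> \<le> (norm H * norm e) * norm e"
      by (intro mult_right_mono norm_blinfun) auto
    also have "\<dots> \<le> M * (norm e)\<^sup>2"
      by (simp add: M_def algebra_simps power2_eq_square)
    finally show ?thesis .
  qed
  \<comment> \<open>the minimum over \<open>t\<close> of the bound for the form at \<open>d + t e\<close> is at \<open>t = -1/M\<close>\<close>
  have "0 \<le> H (d - (1 / M) *\<^sub>R e) \<bullet> (d - (1 / M) *\<^sub>R e)" by (rule psd)
  also have "\<dots> = H d \<bullet> d - 2 / M * (norm e)\<^sup>2 + 1 / M * (1 / M) * (H e \<bullet> e)"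
    using sym[of e d] unfolding power2_norm_eq_inner
    by (simp add: blinfun.diff_right blinfun.scaleR_right inner_diff_left inner_diff_right
        e_def[symmetric] inner_commute diff_divide_distrib)
  also have "\<dots> \<le> H d \<bullet> d - 2 / M * (norm e)\<^sup>2 + 1 / M * (1 / M) * (M * (norm e)\<^sup>2)"
    using \<open>H e \<bullet> e \<le> _\<close> by (intro add_left_mono mult_left_mono) auto
  also have "\<dots> = H d \<bullet> d - (norm e)\<^sup>2 / M"
    using M by (simp add: field_simps power2_eq_square)
  finally show ?thesis
    using M unfolding e_def M_def[symmetric] by (simp add: field_simps)
qed

section \<open>Minimization of coercive functions\<close>

lemma continuous_attains_inf_bounded_sublevel:
  fixes h :: "'a::heine_borel \<Rightarrow> real"
  assumes "closed S" "x0 \<in> S" "continuous_on S h" "bounded {x \<in> S. h x \<le> h x0}"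
  obtains x where "x \<in> S" "\<And>y. y \<in> S \<Longrightarrow> h x \<le> h y"
proof -
  let ?K = "{x \<in> S. h x \<le> h x0}"
  have "closed ?K"
    using assms by (intro continuous_on_closed_Collect_le continuous_intros)
  then have "compact ?K" using assms(4) by (simp add: compact_eq_bounded_closed)
  moreover have "continuous_on ?K h" by (rule continuous_on_subset[OF assms(3)]) auto
  ultimately obtain x where x: "x \<in> ?K" "\<And>y. y \<in> ?K \<Longrightarrow> h x \<le> h y"
    using continuous_attains_inf[of ?K h] assms(2) by auto
  show thesis
    by (rule that[of x]) (use x in force)+
qed

lemma argmin_on_iff:
  fixes h :: "'a \<Rightarrow> 'b::linorder"
  shows "x \<in> argmin_on h S \<longleftrightarrow> x \<in> S \<and> (\<forall>y\<in>S. h x \<le> h y)"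
  by (auto simp: argmin_on_def is_arg_min_linorder)

lemma quadratic_argmin_exists:
  fixes H :: "'a::euclidean_space \<Rightarrow>\<^sub>L 'a"
  assumes L: "subspace L" and "\<mu> > 0" and coercive: "\<And>d. d \<in> L \<Longrightarrow> \<mu> * (norm d)\<^sup>2 \<le> H d \<bullet> d"
  obtains d where "d \<in> argmin_on (\<lambda>d. 1 / 2 * (blinfun_apply H d \<bullet> d) - c \<bullet> d) L"
proof -
  let ?q = "\<lambda>d. 1 / 2 * (blinfun_apply H d \<bullet> d) - c \<bullet> d"
  have "norm d \<le> 2 * norm c / \<mu>" if "d \<in> L" "?q d \<le> ?q 0" for d
  proof (cases "d = 0")
    case False
    have "\<mu> / 2 * (norm d)\<^sup>2 \<le> c \<bullet> d" using coercive[OF that(1)] that(2) by simp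
    also have "\<dots> \<le> norm c * norm d" by (rule norm_cauchy_schwarz)
    finally show ?thesis using False \<open>\<mu> > 0\<close> by (simp add: field_simps power2_eq_square)
  qed (use \<open>\<mu> > 0\<close> in simp)
  then have "bounded {d \<in> L. ?q d \<le> ?q 0}"
    by (intro boundedI[where B = "2 * norm c / \<mu>"]) auto
  moreover have "continuous_on L ?q" by (intro continuous_intros)
  ultimately obtain d where "d \<in> L" "\<And>y. y \<in> L \<Longrightarrow> ?q d \<le> ?q y"
    using continuous_attains_inf_bounded_sublevel[of L 0 ?q] closed_subspace[OF L] subspace_0[OF L]
    by blast
  then show thesis by (intro that) (auto simp: argmin_on_iff)
qed

lemma quadratic_argmin_normal_equation:
  fixes H :: "'a::real_inner \<Rightarrow>\<^sub>L 'a"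
  assumes sym: "\<And>a b. H a \<bullet> b = a \<bullet> H b" and L: "subspace L"
    and d: "d \<in> argmin_on (\<lambda>d. 1 / 2 * (blinfun_apply H d \<bullet> d) - c \<bullet> d) L" and e: "e \<in> L"
  shows "H d \<bullet> e = c \<bullet> e"
proof -
  let ?q = "\<lambda>d. 1 / 2 * (blinfun_apply H d \<bullet> d) - c \<bullet> d"
  have dL: "d \<in> L" and min: "\<And>y. y \<in> L \<Longrightarrow> ?q d \<le> ?q y"
    using d by (auto simp: argmin_on_iff)
  let ?p = "\<lambda>t. ?q d + t * (H d \<bullet> e - c \<bullet> e) + t\<^sup>2 / 2 * (H e \<bullet> e)"
  have "?p 0 \<le> ?p t" for t
  proof -
    have "d + t *\<^sub>R e \<in> L" using dL e L by (simp add: subspace_add subspace_scale)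
    then have "?q d \<le> ?q (d + t *\<^sub>R e)" by (rule min)
    also have "\<dots> = ?p t"
      using sym[of e d]
      by (simp add: blinfun.add_right blinfun.scaleR_right inner_add_left inner_add_right
          inner_commute power2_eq_square algebra_simps)
    finally show ?thesis by simp
  qed
  then have "\<forall>y. \<bar>0 - y\<bar> < 1 \<longrightarrow> ?p 0 \<le> ?p y" by blast
  moreover have "(?p has_real_derivative (H d \<bullet> e - c \<bullet> e)) (at 0)"
    by (auto intro!: derivative_eq_intros)
  ultimately have "H d \<bullet> e - c \<bullet> e = 0"
    using DERIV_local_min[of ?p _ 0 1] zero_less_one by blast
  then show ?thesis by simp
qed

section \<open>Subgradients through the epigraph\<close>

lemma subdifferential_iff_epi:
  "z \<in> subdifferential g x \<longleftrightarrow>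
    (\<exists>r. g x = ereal r \<and> (\<forall>y s. (y, s) \<in> epi g \<longrightarrow> r + z \<bullet> (y - x) \<le> s))"
proof
  assume z: "z \<in> subdifferential g x"
  then obtain r where r: "g x = ereal r"
    unfolding subdifferential_def by (cases "g x") auto
  have "r + z \<bullet> (y - x) \<le> s" if "(y, s) \<in> epi g" for y s
  proof -
    have "ereal (r + z \<bullet> (y - x)) \<le> g y"
      using z r unfolding subdifferential_def by auto
    also have "\<dots> \<le> ereal s" using that by (simp add: epi_def)
    finally show ?thesis by simp
  qed
  then show "\<exists>r. g x = ereal r \<and> (\<forall>y s. (y, s) \<in> epi g \<longrightarrow> r + z \<bullet> (y - x) \<le> s)"
    using r by blast
next
  assume "\<exists>r. g x = ereal r \<and> (\<forall>y s. (y, s) \<in> epi g \<longrightarrow> r + z \<bullet> (y - x) \<le> s)"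
  then obtain r where r: "g x = ereal r"
    and *: "\<And>y s. (y, s) \<in> epi g \<Longrightarrow> r + z \<bullet> (y - x) \<le> s" by blast
  have "ereal (r + z \<bullet> (y - x)) \<le> g y" for y
    by (rule ereal_le_real) (use * in \<open>auto simp: epi_def\<close>)
  then show "z \<in> subdifferential g x" unfolding subdifferential_def using r by auto
qed

lemma subdifferentialD:
  assumes "z \<in> subdifferential g x"
  obtains r where "g x = ereal r" "\<And>y s. (y, s) \<in> epi g \<Longrightarrow> r + z \<bullet> (y - x) \<le> s"
  using assms by (auto simp: subdifferential_iff_epi)

lemma closed_subdifferential: "closed (subdifferential g x)"
proof (cases "\<exists>r. g x = ereal r")
  case True
  then obtain r where r: "g x = ereal r" ..
  have "subdifferential g x = (\<Inter>p\<in>epi g. {z. r + z \<bullet> (fst p - x) \<le> snd p})"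
    by (force simp: subdifferential_iff_epi r)
  moreover have "closed \<dots>"
    by (intro closed_INT ballI closed_Collect_le continuous_intros)
  ultimately show ?thesis by simp
next
  case False
  then have "subdifferential g x = {}" by (auto simp: subdifferential_iff_epi)
  then show ?thesis by simp
qed

lemma convex_subdifferential: "convex (subdifferential g x)"
proof (rule convexI)
  fix v w :: 'a and a b :: real
  assume v: "v \<in> subdifferential g x" and w: "w \<in> subdifferential g x"
    and ab: "0 \<le> a" "0 \<le> b" "a + b = 1"
  obtain r where r: "g x = ereal r" "\<And>y s. (y, s) \<in> epi g \<Longrightarrow> r + v \<bullet> (y - x) \<le> s"
    using v by (rule subdifferentialD) blast
  have w: "r + w \<bullet> (y - x) \<le> s" if "(y, s) \<in> epi g" for y s
    using w r(1) that by (auto simp: subdifferential_iff_epi)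
  have "r + (a *\<^sub>R v + b *\<^sub>R w) \<bullet> (y - x) \<le> s" if "(y, s) \<in> epi g" for y s
  proof -
    have "a * (r + v \<bullet> (y - x)) + b * (r + w \<bullet> (y - x)) \<le> a * s + b * s"
      using r(2)[OF that] w[OF that] ab by (intro add_mono mult_left_mono) auto
    moreover have "a * s + b * s = s" "a * r + b * r = r"
      using ab by (metis distrib_right mult_1)+
    ultimately show ?thesis by (simp add: inner_add_left distrib_left)
  qed
  then show "a *\<^sub>R v + b *\<^sub>R w \<in> subdifferential g x"
    using r(1) by (auto simp: subdifferential_iff_epi)
qed

lemma subdifferential_monotone:
  assumes "v \<in> subdifferential g x" "w \<in> subdifferential g y"
  shows "0 \<le> (v - w) \<bullet> (x - y)"
proof -
  obtain r where r: "g x = ereal r" "\<And>y s. (y, s) \<in> epi g \<Longrightarrow> r + v \<bullet> (y - x) \<le> s"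
    using assms(1) by (rule subdifferentialD) blast
  obtain s where s: "g y = ereal s" "\<And>x r. (x, r) \<in> epi g \<Longrightarrow> s + w \<bullet> (x - y) \<le> r"
    using assms(2) by (rule subdifferentialD) blast
  have "r + v \<bullet> (y - x) \<le> s" "s + w \<bullet> (x - y) \<le> r"
    using r s by (auto simp: epi_def)
  then show ?thesis by (simp add: algebra_simps)
qed

lemma resolvent_nonexpansive:
  assumes v: "v \<in> subdifferential g x" and w: "w \<in> subdifferential g y" and "0 \<le> \<alpha>"
  shows "norm (x - y) \<le> norm ((x + \<alpha> *\<^sub>R v) - (y + \<alpha> *\<^sub>R w))"
proof (cases "x = y")
  case False
  let ?h = "(x + \<alpha> *\<^sub>R v) - (y + \<alpha> *\<^sub>R w)"
  have "(norm (x - y))\<^sup>2 \<le> (x - y) \<bullet> (x - y) + \<alpha> * ((v - w) \<bullet> (x - y))"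
    using subdifferential_monotone[OF v w] \<open>0 \<le> \<alpha>\<close> by (simp add: power2_norm_eq_inner)
  also have "\<dots> = ?h \<bullet> (x - y)" by (simp add: algebra_simps)
  also have "\<dots> \<le> norm ?h * norm (x - y)" by (rule norm_cauchy_schwarz)
  finally show ?thesis using False by (simp add: power2_eq_square)
qed simp

text \<open>First-order condition for a local minimizer of \<open>h + g\<close>. The function \<open>h\<close> need not be convex;
  convexity of the epigraph of \<open>g\<close> turns the local condition into a global subgradient
  inequality.\<close>

lemma fermat_rule_local:
  assumes conv: "convex (epi g)" and grad: "GDERIV h x :> d" and "0 < \<gamma>"
    and fin: "g x = ereal r"
    and min: "\<And>y s. y \<in> cball x \<gamma> \<Longrightarrow> (y, s) \<in> epi g \<Longrightarrow> h x + r \<le> h y + s"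
  shows "- d \<in> subdifferential g x"
proof -
  have "r + (- d) \<bullet> (y - x) \<le> s" if ys: "(y, s) \<in> epi g" for y s
  proof (rule ccontr)
    assume neg: "\<not> ?thesis"
    let ?p = "\<lambda>t. h (x + t *\<^sub>R (y - x)) + t * (s - r)"
    have "((\<lambda>t. h (x + t *\<^sub>R (y - x))) has_real_derivative (y - x) \<bullet> d) (at 0)"
      using grad by (intro GDERIV_along_line) simp
    then have "(?p has_real_derivative ((y - x) \<bullet> d + (s - r))) (at 0)"
      by (auto intro!: derivative_eq_intros)
    moreover have "(y - x) \<bullet> d + (s - r) < 0"
      using neg by (simp add: inner_commute)
    ultimately obtain e where e: "e > 0" "\<And>t. 0 < t \<Longrightarrow> t < e \<Longrightarrow> ?p t < ?p 0"
      using DERIV_neg_dec_right[of ?p "(y - x) \<bullet> d + (s - r)" 0] by auto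
    define t where "t = min (min (e / 2) 1) (\<gamma> / (norm (y - x) + 1))"
    have n: "norm (y - x) + 1 > 0" by (simp add: add_nonneg_pos)
    have t: "0 < t" "t < e" "t \<le> 1" "t \<le> \<gamma> / (norm (y - x) + 1)"
      using e(1) \<open>0 < \<gamma>\<close> n by (auto simp: t_def)
    have "t * norm (y - x) \<le> t * (norm (y - x) + 1)" using t by simp
    also have "\<dots> \<le> \<gamma>" using t(4) n by (simp add: field_simps)
    finally have "x + t *\<^sub>R (y - x) \<in> cball x \<gamma>"
      using t by (simp add: dist_norm)
    moreover have "(x + t *\<^sub>R (y - x), r + t * (s - r)) \<in> epi g"
    proof -
      have "(x, r) \<in> epi g" using fin by (simp add: epi_def)
      then have "(1 - t) *\<^sub>R (x, r) + t *\<^sub>R (y, s) \<in> epi g"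
        using conv ys t by (intro convexD) auto
      then show ?thesis by (simp add: algebra_simps)
    qed
    ultimately have "h x + r \<le> h (x + t *\<^sub>R (y - x)) + (r + t * (s - r))" by (rule min)
    then show False using e(2)[OF t(1,2)] by simp
  qed
  then show ?thesis using fin by (auto simp: subdifferential_iff_epi)
qed

section \<open>Conjugates\<close>

lemma conjugate_le_iff:
  "conjugate g v \<le> ereal c \<longleftrightarrow> (\<forall>y s. (y, s) \<in> epi g \<longrightarrow> v \<bullet> y - s \<le> c)"
proof -
  have "ereal (v \<bullet> y) - g y \<le> ereal c \<longleftrightarrow> (\<forall>s. g y \<le> ereal s \<longrightarrow> v \<bullet> y - s \<le> c)" for y
  proof (cases "g y")
    case MInf
    then show ?thesis by (auto intro: exI[of _ "v \<bullet> y - c - 1"])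
  qed auto
  then show ?thesis unfolding conjugate_def by (auto simp: SUP_le_iff epi_def)
qed

text \<open>The inclusion from left to right uses closedness: if the point \<open>(x, z \<bullet> x - conjugate g z)\<close> were
  outside the epigraph, a separating hyperplane would yield a vector violating the subgradient
  inequality of the conjugate at \<open>z\<close>.\<close>

lemma subdifferential_conjugate:
  fixes g :: "'a::euclidean_space \<Rightarrow> ereal"
  assumes conv: "convex (epi g)" and clos: "closed (epi g)" and "proper g"
  shows "subdifferential (conjugate g) z = {x. z \<in> subdifferential g x}"
proof (intro set_eqI iffI)
  fix x assume "x \<in> {x. z \<in> subdifferential g x}"
  then obtain r where r: "g x = ereal r" "\<And>y s. (y, s) \<in> epi g \<Longrightarrow> r + z \<bullet> (y - x) \<le> s"
    by (auto elim: subdifferentialD)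
  have ge: "ereal (v \<bullet> x - r) \<le> conjugate g v" for v
    unfolding conjugate_def by (rule SUP_upper2[of x]) (auto simp: r)
  have "conjugate g z \<le> ereal (z \<bullet> x - r)"
    unfolding conjugate_le_iff using r(2) by (auto simp: inner_diff_right algebra_simps)
  then have "conjugate g z = ereal (z \<bullet> x - r)" using ge by (intro antisym)
  then show "x \<in> subdifferential (conjugate g) z"
    unfolding subdifferential_def using ge by (auto simp: inner_diff_right inner_commute)
next
  fix x assume x: "x \<in> subdifferential (conjugate g) z"
  then obtain G where G: "conjugate g z = ereal G"
    unfolding subdifferential_def by (cases "conjugate g z") auto
  have x: "ereal (G + x \<bullet> (v - z)) \<le> conjugate g v" for v
    using x G unfolding subdifferential_def by auto
  have Gz: "z \<bullet> y - s \<le> G" if "(y, s) \<in> epi g" for y s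
    using G conjugate_le_iff[of g z G] that by auto
  define r where "r = z \<bullet> x - G"
  have "(x, r) \<in> epi g"
  proof (rule ccontr)
    assume "(x, r) \<notin> epi g"
    then obtain p c where "p \<bullet> (x, r) < c" "\<forall>q\<in>epi g. p \<bullet> q > c"
      using separating_hyperplane_closed_point[OF conv clos] by blast
    then obtain a b where xr: "a \<bullet> x + b * r < c"
      and sep: "\<And>y s. (y, s) \<in> epi g \<Longrightarrow> c < a \<bullet> y + b * s"
      by (cases p) (fastforce simp: inner_Pair)
    have b: "b \<ge> 0"
    proof (rule ccontr)
      assume "\<not> b \<ge> 0"
      obtain y where "g y \<noteq> \<infinity>" "g y \<noteq> - \<infinity>" using \<open>proper g\<close> by (auto simp: proper_def)
      then obtain s where s: "g y = ereal s" by (cases "g y") auto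
      define S where "S = max s ((c - a \<bullet> y) / b)"
      have "(y, S) \<in> epi g" by (simp add: epi_def s S_def)
      then have "c < a \<bullet> y + b * S" by (rule sep)
      moreover have "b * S \<le> c - a \<bullet> y"
      proof -
        have "b * S \<le> b * ((c - a \<bullet> y) / b)"
          using \<open>\<not> b \<ge> 0\<close> by (intro mult_left_mono_neg) (auto simp: S_def)
        then show ?thesis using \<open>\<not> b \<ge> 0\<close> by simp
      qed
      ultimately show False by simp
    qed
    \<comment> \<open>adding the inequality \<open>s - z \<bullet> y \<ge> - G\<close> makes the coefficient of \<open>s\<close> positive, also
      when the separating hyperplane is vertical\<close>
    define v where "v = (1 / (b + 1)) *\<^sub>R (z - a)"
    have "v \<bullet> y - s \<le> (G - c) / (b + 1)" if "(y, s) \<in> epi g" for y s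
    proof -
      have "z \<bullet> y - a \<bullet> y - (b + 1) * s \<le> G - c"
        using sep[OF that] Gz[OF that] by (simp add: algebra_simps)
      then have "(z \<bullet> y - a \<bullet> y - (b + 1) * s) / (b + 1) \<le> (G - c) / (b + 1)"
        using b by (intro divide_right_mono) auto
      moreover have "(z \<bullet> y - a \<bullet> y - (b + 1) * s) / (b + 1) = v \<bullet> y - s"
        using b by (simp add: v_def inner_diff_left diff_divide_distrib)
      ultimately show ?thesis by simp
    qed
    then have "conjugate g v \<le> ereal ((G - c) / (b + 1))"
      unfolding conjugate_le_iff by blast
    with x[of v] have "ereal (G + x \<bullet> (v - z)) \<le> ereal ((G - c) / (b + 1))" by (rule order_trans)
    then have "(b + 1) * (G + x \<bullet> (v - z)) \<le> G - c" using b by (simp add: field_simps)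
    moreover have "(b + 1) * (x \<bullet> v) = x \<bullet> z - x \<bullet> a"
      using b by (simp add: v_def inner_diff_right)
    ultimately have "(b + 1) * G + (x \<bullet> z - x \<bullet> a) - (b + 1) * (x \<bullet> z) \<le> G - c"
      by (simp add: inner_diff_right distrib_left right_diff_distrib)
    then show False
      using xr by (simp add: r_def algebra_simps inner_commute)
  qed
  then have "g x \<le> ereal r" by (simp add: epi_def)
  then obtain r' where r': "g x = ereal r'" "r' \<le> r"
    using \<open>proper g\<close> by (cases "g x") (auto simp: proper_def)
  have "r' + z \<bullet> (y - x) \<le> s" if "(y, s) \<in> epi g" for y s
    using Gz[OF that] r'(2) by (simp add: r_def inner_diff_right)
  then show "x \<in> {x. z \<in> subdifferential g x}"
    using r'(1) by (auto simp: subdifferential_iff_epi)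
qed

section \<open>Local structure of polyhedral subdifferentials\<close>

text \<open>The minimizers of \<open>g\<close> tilted by \<open>z\<close> form the projection of the face of the epigraph exposed
  by \<open>(- z, 1)\<close>, and a polyhedron has finitely many faces.\<close>

lemma finite_range_subdifferential_conjugate:
  fixes g :: "'a::euclidean_space \<Rightarrow> ereal"
  assumes poly: "polyhedron (epi g)" and "proper g"
  shows "finite (range (subdifferential (conjugate g)))"
proof -
  note conv = polyhedron_imp_convex[OF poly] and clos = polyhedron_imp_closed[OF poly]
  let ?A = "subdifferential (conjugate g)"
  have A: "x \<in> ?A z \<longleftrightarrow> z \<in> subdifferential g x" for x z
    using subdifferential_conjugate[OF conv clos \<open>proper g\<close>] by auto
  have "?A z \<in> insert {} ((`) fst ` {F. F face_of epi g})" for z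
  proof (cases "?A z = {}")
    case False
    then obtain x where "z \<in> subdifferential g x" using A by blast
    then obtain r where r: "g x = ereal r" "\<And>y s. (y, s) \<in> epi g \<Longrightarrow> r + z \<bullet> (y - x) \<le> s"
      by (rule subdifferentialD) blast
    let ?F = "epi g \<inter> {p. (- z, 1) \<bullet> p = r - z \<bullet> x}"
    have "?F face_of epi g"
      using r(2) by (intro face_of_Int_supporting_hyperplane_ge conv)
        (auto simp: inner_diff_right algebra_simps)
    moreover have "?A z = fst ` ?F"
    proof (intro set_eqI iffI)
      fix y assume "y \<in> ?A z"
      then obtain s where s: "g y = ereal s" "\<And>x r. (x, r) \<in> epi g \<Longrightarrow> s + z \<bullet> (x - y) \<le> r"
        using A by (auto elim: subdifferentialD)
      have "(y, s) \<in> epi g" "(x, r) \<in> epi g" using r s by (auto simp: epi_def)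
      then have "(y, s) \<in> ?F"
        using r(2)[of y s] s(2)[of x r] by (auto simp: inner_diff_right)
      then show "y \<in> fst ` ?F" by force
    next
      fix y assume "y \<in> fst ` ?F"
      then obtain s where ys: "(y, s) \<in> epi g" and s: "s = r + z \<bullet> (y - x)"
        by (fastforce simp: inner_diff_right)
      have "ereal s \<le> g y"
        by (rule ereal_le_real) (use r(2)[of y] s in \<open>auto simp: epi_def\<close>)
      then have "g y = ereal s" using ys by (auto simp: epi_def intro: antisym)
      moreover have "s + z \<bullet> (y' - y) \<le> s'" if "(y', s') \<in> epi g" for y' s'
        using r(2)[OF that] s by (simp add: inner_diff_right)
      ultimately show "y \<in> ?A z" using A by (auto simp: subdifferential_iff_epi)
    qed
    ultimately show ?thesis by blast
  qed simp
  then have "range ?A \<subseteq> insert {} ((`) fst ` {F. F face_of epi g})" by blast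
  then show ?thesis
    using finite_polyhedron_faces[OF poly] by (meson finite.insertI finite_imageI finite_subset)
qed

text \<open>Each set \<open>F\<close> of the finite family is contained in the subdifferential of the conjugate at \<open>z\<close>
  for a closed set of \<open>z\<close>. Near \<open>zbar\<close> only those \<open>F\<close> occur whose closed set contains \<open>zbar\<close>.\<close>

lemma polyhedral_subdifferential_conjugate_upper_local:
  fixes g :: "'a::euclidean_space \<Rightarrow> ereal"
  assumes poly: "polyhedron (epi g)" and "proper g"
  obtains \<delta> where "\<delta> > 0"
    "\<And>z. norm (z - zbar) < \<delta> \<Longrightarrow>
      subdifferential (conjugate g) z \<subseteq> subdifferential (conjugate g) zbar"
proof -
  note conv = polyhedron_imp_convex[OF poly] and clos = polyhedron_imp_closed[OF poly]
  let ?A = "subdifferential (conjugate g)"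
  let ?D = "\<lambda>F. {z. F \<subseteq> ?A z}"
  have "?D F = (\<Inter>x\<in>F. subdifferential g x)" for F
    using subdifferential_conjugate[OF conv clos \<open>proper g\<close>] by auto
  then have "closed (?D F)" for F by (auto intro!: closed_INT closed_subdifferential)
  then have "closed (\<Union>F\<in>{F\<in>range ?A. zbar \<notin> ?D F}. ?D F)"
    using finite_range_subdifferential_conjugate[OF poly \<open>proper g\<close>] by (intro closed_UN) auto
  then have "open (- (\<Union>F\<in>{F\<in>range ?A. zbar \<notin> ?D F}. ?D F))" by (rule open_Compl)
  moreover have "zbar \<in> - (\<Union>F\<in>{F\<in>range ?A. zbar \<notin> ?D F}. ?D F)" by auto
  ultimately obtain \<delta> where "\<delta> > 0"
    "ball zbar \<delta> \<subseteq> - (\<Union>F\<in>{F\<in>range ?A. zbar \<notin> ?D F}. ?D F)"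
    by (meson open_contains_ball)
  then show thesis
    by (intro that[of \<delta>]) (auto simp: subset_iff dist_norm norm_minus_commute)
qed

text \<open>The counterpart in the primal variable: a member of the finite family that meets a small
  neighbourhood of \<open>x\<close> contains \<open>x\<close>, because all members are closed.\<close>

lemma polyhedral_subgradient_extends_local:
  fixes g :: "'a::euclidean_space \<Rightarrow> ereal"
  assumes poly: "polyhedron (epi g)" and "proper g"
  obtains \<delta> where "\<delta> > 0"
    "\<And>y z. norm (y - x) < \<delta> \<Longrightarrow> z \<in> subdifferential g y \<Longrightarrow> z \<in> subdifferential g x"
proof -
  note conv = polyhedron_imp_convex[OF poly] and clos = polyhedron_imp_closed[OF poly]
  let ?A = "subdifferential (conjugate g)"
  let ?B = "\<Union>{F\<in>range ?A. x \<notin> F}"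
  have "closed ?B"
    using finite_range_subdifferential_conjugate[OF poly \<open>proper g\<close>]
    by (intro closed_Union) (auto intro: closed_subdifferential)
  then have "open (- ?B)" by (rule open_Compl)
  moreover have "x \<in> - ?B" by auto
  ultimately obtain \<delta> where \<delta>: "\<delta> > 0" "ball x \<delta> \<subseteq> - ?B"
    by (meson open_contains_ball)
  have "x \<in> ?A z" if "norm (y - x) < \<delta>" "y \<in> ?A z" for y z
    using \<delta>(2) that by (auto simp: subset_iff dist_norm norm_minus_commute)
  then show thesis
    using that \<delta>(1) subdifferential_conjugate[OF conv clos \<open>proper g\<close>] by auto
qed

section \<open>The proximal step\<close>

lemma prox_imp_subgradient:
  assumes "convex (epi g)" "proper g" "\<alpha> > 0" and y: "y \<in> prox \<alpha> g w"
  shows "(1 / \<alpha>) *\<^sub>R (w - y) \<in> subdifferential g y"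
proof -
  let ?h = "\<lambda>y. 1 / (2 * \<alpha>) * (norm (y - w))\<^sup>2"
  have min: "g y + ereal (?h y) \<le> g y' + ereal (?h y')" for y'
    using y by (auto simp: prox_def argmin_on_iff)
  obtain y0 where "g y0 \<noteq> \<infinity>" using \<open>proper g\<close> by (auto simp: proper_def)
  then have "g y \<noteq> \<infinity>" using min[of y0] by auto
  then obtain r where r: "g y = ereal r"
    using \<open>proper g\<close> by (cases "g y") (auto simp: proper_def)
  have "GDERIV ?h y :> (1 / \<alpha>) *\<^sub>R (y - w)"
    unfolding gderiv_def power2_norm_eq_inner
    using \<open>\<alpha> > 0\<close> by (auto intro!: derivative_eq_intros ext simp: inner_commute inner_diff_right field_simps)
  moreover have "?h y + r \<le> ?h y' + s" if "(y', s) \<in> epi g" for y' s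
  proof -
    have "g y + ereal (?h y) \<le> g y' + ereal (?h y')" by (rule min)
    also have "\<dots> \<le> ereal s + ereal (?h y')"
      using that by (intro add_right_mono) (simp add: epi_def)
    finally show ?thesis using r by simp
  qed
  ultimately have "- ((1 / \<alpha>) *\<^sub>R (y - w)) \<in> subdifferential g y"
    using r by (intro fermat_rule_local[OF assms(1), of ?h _ _ 1]) auto
  then show ?thesis by (simp add: algebra_simps)
qed

lemma prox_nonempty:
  fixes g :: "'a::euclidean_space \<Rightarrow> ereal"
  assumes clos: "closed (epi g)" and z: "z \<in> subdifferential g x" and "\<alpha> > 0"
  obtains y where "y \<in> prox \<alpha> g w"
proof -
  obtain r where r: "g x = ereal r" "\<And>y s. (y, s) \<in> epi g \<Longrightarrow> r + z \<bullet> (y - x) \<le> s"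
    using z by (rule subdifferentialD) blast
  define h where "h y = 1 / (2 * \<alpha>) * (norm (y - w))\<^sup>2" for y
  let ?F = "\<lambda>p. snd p + h (fst p)"
  define c where "c = ?F (x, r)"
  define c' where "c' = c - r - z \<bullet> (w - x)"
  define R where "R = 2 * \<alpha> * (\<bar>c'\<bar> + norm z) + 1"
  have xr: "(x, r) \<in> epi g" using r by (simp add: epi_def)
  have "norm (y - w) \<le> R \<and> r - norm z * (R + norm (w - x)) \<le> s \<and> s \<le> c"
    if ys: "(y, s) \<in> epi g" and le: "?F (y, s) \<le> c" for y s
  proof -
    let ?\<rho> = "norm (y - w)"
    have split: "z \<bullet> (y - x) = z \<bullet> (y - w) + z \<bullet> (w - x)" by (simp add: inner_diff_right)
    have zy: "- (norm z * ?\<rho>) \<le> z \<bullet> (y - w)" "- (norm z * norm (w - x)) \<le> z \<bullet> (w - x)"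
      using Cauchy_Schwarz_ineq2[of z "y - w"] Cauchy_Schwarz_ineq2[of z "w - x"] by linarith+
    have "h y \<le> c' + norm z * ?\<rho>"
      using r(2)[OF ys] le zy(1) split by (simp add: c'_def)
    then have sq: "?\<rho> * ?\<rho> \<le> 2 * \<alpha> * (c' + norm z * ?\<rho>)"
      using \<open>\<alpha> > 0\<close> by (simp add: h_def field_simps power2_eq_square)
    have \<rho>: "?\<rho> \<le> R"
    proof (rule ccontr)
      assume "\<not> ?\<rho> \<le> R"
      moreover have "1 \<le> R" using \<open>\<alpha> > 0\<close> by (simp add: R_def)
      ultimately have gt: "R < ?\<rho>" "1 \<le> ?\<rho>" by auto
      have "\<bar>c'\<bar> * 1 \<le> \<bar>c'\<bar> * ?\<rho>" using gt(2) by (intro mult_left_mono) auto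
      then have "2 * \<alpha> * (c' + norm z * ?\<rho>) \<le> 2 * \<alpha> * (\<bar>c'\<bar> * ?\<rho> + norm z * ?\<rho>)"
        using \<open>\<alpha> > 0\<close> by (intro mult_left_mono) auto
      also have "\<dots> = (R - 1) * ?\<rho>" by (simp add: R_def algebra_simps)
      also have "\<dots> < ?\<rho> * ?\<rho>" using gt by (intro mult_strict_right_mono) auto
      finally show False using sq by simp
    qed
    have "norm z * ?\<rho> \<le> norm z * R" using \<rho> by (intro mult_left_mono) auto
    then have "r - norm z * (R + norm (w - x)) \<le> s"
      using r(2)[OF ys] zy split by (simp add: distrib_left)
    moreover have "s \<le> c" using le \<open>\<alpha> > 0\<close> by (simp add: h_def) (smt (verit) divide_nonneg_pos zero_le_power2)
    ultimately show ?thesis using \<rho> by simp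
  qed
  then have "{p \<in> epi g. ?F p \<le> ?F (x, r)} \<subseteq> cball w R \<times> {r - norm z * (R + norm (w - x))..c}"
    by (auto simp: c_def dist_norm norm_minus_commute)
  then have "bounded {p \<in> epi g. ?F p \<le> ?F (x, r)}"
    by (rule bounded_subset[rotated]) (intro bounded_Times bounded_cball bounded_closed_interval)
  moreover have "continuous_on (epi g) ?F"
    unfolding h_def by (intro continuous_intros)
  ultimately obtain p where p: "p \<in> epi g" "\<And>q. q \<in> epi g \<Longrightarrow> ?F p \<le> ?F q"
    using continuous_attains_inf_bounded_sublevel[OF clos xr, of ?F] by blast
  obtain y s where ys: "p = (y, s)" by (cases p)
  have "g y + ereal (h y) \<le> g y' + ereal (h y')" for y'
  proof (rule ereal_le_real)
    fix t assume "g y' + ereal (h y') \<le> ereal t"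
    then have "(y', t - h y') \<in> epi g" by (cases "g y'") (auto simp: epi_def)
    then have "s + h y \<le> t" using p(2)[of "(y', t - h y')"] ys by simp
    then show "g y + ereal (h y) \<le> ereal t"
      using p(1) ys by (cases "g y") (auto simp: epi_def)
  qed
  then show thesis
    by (intro that[of y]) (simp add: prox_def argmin_on_iff h_def)
qed

section \<open>Second-order consequences of tilt stability\<close>

lemma tilt_stable_imp_critical:
  assumes conv: "convex (epi g)" and "proper g" and grad: "GDERIV f xbar :> d"
    and tilt: "tilt_stable_minimizer (\<lambda>x. ereal (f x) + g x) xbar"
  shows "- d \<in> subdifferential g xbar"
proof -
  obtain \<gamma> where "\<gamma> > 0" and \<gamma>: "tilt_argmin (\<lambda>x. ereal (f x) + g x) xbar \<gamma> 0 = {xbar}"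
    using tilt by (auto simp: tilt_stable_minimizer_def)
  have "g xbar \<noteq> \<infinity>" using tilt by (auto simp: tilt_stable_minimizer_def)
  then obtain r where r: "g xbar = ereal r"
    using \<open>proper g\<close> by (cases "g xbar") (auto simp: proper_def)
  have "f xbar + r \<le> f y + s" if "y \<in> cball xbar \<gamma>" "(y, s) \<in> epi g" for y s
  proof -
    have "xbar \<in> tilt_argmin (\<lambda>x. ereal (f x) + g x) xbar \<gamma> 0" using \<gamma> by simp
    then have "ereal (f xbar) + g xbar \<le> ereal (f y) + g y"
      using that(1) by (simp add: tilt_argmin_def argmin_on_iff zero_ereal_def[symmetric])
    also have "\<dots> \<le> ereal (f y) + ereal s"
      using that(2) by (intro add_left_mono) (simp add: epi_def)
    finally show ?thesis by (simp add: r)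
  qed
  then show ?thesis by (rule fermat_rule_local[where \<gamma> = \<gamma> and r = r, OF conv grad \<open>\<gamma> > 0\<close> r])
qed

lemma tilt_argminI:
  assumes "convex_on UNIV f" and grad: "GDERIV f x :> d"
    and sub: "v - d \<in> subdifferential g x" and "x \<in> cball xbar \<gamma>"
  shows "x \<in> tilt_argmin (\<lambda>x. ereal (f x) + g x) xbar \<gamma> v"
proof -
  obtain r where r: "g x = ereal r" using sub by (auto simp: subdifferential_iff_epi)
  have "ereal (f x) + g x - ereal (v \<bullet> x) \<le> ereal (f y) + g y - ereal (v \<bullet> y)" for y
  proof -
    have f: "f x + d \<bullet> (y - x) \<le> f y" by (rule convex_gradient_inequality[OF assms(1) grad])
    have "ereal (r + (v - d) \<bullet> (y - x)) \<le> g y"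
      using sub r by (auto simp: subdifferential_def)
    then show ?thesis
      using f r by (cases "g y") (auto simp: algebra_simps)
  qed
  then show ?thesis using assms(4) by (simp add: tilt_argmin_def argmin_on_iff)
qed

text \<open>The points where \<open>- Df xbar\<close> is a subgradient of \<open>g\<close> minimize tilted problems; the tilt
  at \<open>x\<close> is \<open>Df x - Df xbar\<close>. Lipschitz continuity of the argmin map thus makes the gradient
  expanding on these points.\<close>

lemma tilt_stable_gradient_expanding:
  fixes f :: "'a::euclidean_space \<Rightarrow> real"
  assumes convf: "convex_on UNIV f" and grad: "\<And>x. GDERIV f x :> Df x"
    and cont: "isCont Df xbar"
    and tilt: "tilt_stable_minimizer (\<lambda>x. ereal (f x) + g x) xbar"
  obtains \<rho> K where "\<rho> > 0" "K \<ge> 0"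
    "\<And>x y. x \<in> ball xbar \<rho> \<Longrightarrow> y \<in> ball xbar \<rho> \<Longrightarrow> - Df xbar \<in> subdifferential g x \<Longrightarrow>
      - Df xbar \<in> subdifferential g y \<Longrightarrow> norm (x - y) \<le> K * norm (Df x - Df y)"
proof -
  obtain \<gamma> U m K where "\<gamma> > 0" and U: "open U" "0 \<in> U"
    and m: "\<And>v. v \<in> U \<Longrightarrow> tilt_argmin (\<lambda>x. ereal (f x) + g x) xbar \<gamma> v = {m v}"
    and lip: "K-lipschitz_on U m"
    using tilt unfolding tilt_stable_minimizer_def by blast
  obtain e where e: "e > 0" "ball 0 e \<subseteq> U" using U open_contains_ball by blast
  obtain \<rho> where \<rho>: "\<rho> > 0" "\<And>x. dist x xbar < \<rho> \<Longrightarrow> dist (Df x) (Df xbar) < e"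
    using cont e(1) unfolding continuous_at_eps_delta by blast
  have *: "Df x - Df xbar \<in> U \<and> x = m (Df x - Df xbar)"
    if "x \<in> ball xbar (min \<rho> \<gamma>)" "- Df xbar \<in> subdifferential g x" for x
  proof -
    have "Df x - Df xbar \<in> ball 0 e"
      using \<rho>(2)[of x] that(1) by (simp add: dist_norm norm_minus_commute)
    then have U: "Df x - Df xbar \<in> U" using e by blast
    have "x \<in> tilt_argmin (\<lambda>x. ereal (f x) + g x) xbar \<gamma> (Df x - Df xbar)"
      using that by (intro tilt_argminI[OF convf grad]) auto
    then show ?thesis using m[OF U] U by auto
  qed
  have "norm (x - y) \<le> K * norm (Df x - Df y)"
    if xy: "x \<in> ball xbar (min \<rho> \<gamma>)" "y \<in> ball xbar (min \<rho> \<gamma>)"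
      "- Df xbar \<in> subdifferential g x" "- Df xbar \<in> subdifferential g y" for x y
  proof -
    have "norm (x - y) = dist (m (Df x - Df xbar)) (m (Df y - Df xbar))"
      using *[OF xy(1,3)] *[OF xy(2,4)] by (simp add: dist_norm)
    also have "\<dots> \<le> K * dist (Df x - Df xbar) (Df y - Df xbar)"
      using *[OF xy(1,3)] *[OF xy(2,4)] by (intro lipschitz_onD[OF lip]) auto
    finally show ?thesis by (simp add: dist_norm)
  qed
  then show thesis
    using that[of "min \<rho> \<gamma>" K] \<rho>(1) \<open>\<gamma> > 0\<close> lipschitz_on_nonneg[OF lip] by auto
qed

text \<open>An expansion estimate along the ray in direction \<open>d\<close> passes to the derivative.\<close>

lemma derivative_expanding:
  fixes F :: "'a::real_normed_vector \<Rightarrow> 'b::real_normed_vector"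
  assumes F: "(F has_derivative H) (at x)" and "K \<ge> 0" "\<tau> > 0"
    and expand: "\<And>t. 0 < t \<Longrightarrow> t < \<tau> \<Longrightarrow> norm (t *\<^sub>R d) \<le> K * norm (F (x + t *\<^sub>R d) - F x)"
  shows "norm d \<le> K * norm (H d)"
proof (rule field_le_epsilon)
  fix e :: real assume "e > 0"
  define e' where "e' = e / (K * norm d + 1)"
  have pos: "K * norm d + 1 > 0" using \<open>K \<ge> 0\<close> by (simp add: add_nonneg_pos)
  have e': "e' > 0" "K * (e' * norm d) \<le> e"
    using \<open>e > 0\<close> pos by (auto simp: e'_def field_simps)
  obtain \<delta> where \<delta>: "\<delta> > 0"
    "\<And>y. norm (y - x) < \<delta> \<Longrightarrow> norm (F y - F x - H (y - x)) \<le> e' * norm (y - x)"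
    using F e'(1) unfolding has_derivative_at_alt by blast
  define t where "t = min (\<tau> / 2) (\<delta> / (2 * (norm d + 1)))"
  have n: "norm d + 1 > 0" by (simp add: add_nonneg_pos)
  have t: "0 < t" "t < \<tau>" using \<open>\<tau> > 0\<close> \<delta>(1) n by (auto simp: t_def)
  have "t * norm d \<le> t * (norm d + 1)" using t by simp
  also have "\<dots> \<le> \<delta> / (2 * (norm d + 1)) * (norm d + 1)"
    using n by (intro mult_right_mono) (auto simp: t_def)
  also have "\<dots> = \<delta> / 2"
    using nonzero_mult_divide_mult_cancel_right[of "norm d + 1" \<delta> 2] n by simp
  also have "\<dots> < \<delta>" using \<delta>(1) by simp
  finally have "norm (F (x + t *\<^sub>R d) - F x - H (t *\<^sub>R d)) \<le> e' * (t * norm d)"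
    using \<delta>(2)[of "x + t *\<^sub>R d"] t by simp
  moreover have "H (t *\<^sub>R d) = t *\<^sub>R H d"
    using F has_derivative_linear linear_cmul by blast
  ultimately have "norm (F (x + t *\<^sub>R d) - F x) \<le> t * norm (H d) + e' * (t * norm d)"
    using norm_triangle_sub[of "F (x + t *\<^sub>R d) - F x" "t *\<^sub>R H d"] t by simp
  then have "K * norm (F (x + t *\<^sub>R d) - F x) \<le> K * (t * norm (H d) + e' * (t * norm d))"
    using \<open>K \<ge> 0\<close> by (rule mult_left_mono)
  then have "t * norm d \<le> t * (K * norm (H d) + K * (e' * norm d))"
    using expand[OF t] t by (simp add: algebra_simps)
  then have "norm d \<le> K * norm (H d) + K * (e' * norm d)"
    using t by simp
  then show "norm d \<le> K * norm (H d) + e" using e'(2) by simp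
qed

text \<open>From a relative interior point of the set of points with subgradient \<open>- Df xbar\<close> every
  direction of the parallel subspace stays in the set, so the expansion estimate differentiates
  there. The point \<open>xbar\<close> itself may lie on the relative boundary; it is reached as a limit along
  a segment, by continuity of the Hessian.\<close>

lemma tilt_stable_hessian_coercive:
  fixes f :: "'a::euclidean_space \<Rightarrow> real" and D2f :: "'a \<Rightarrow> 'a \<Rightarrow>\<^sub>L 'a"
  assumes convf: "convex_on UNIV f" and grad: "\<And>x. GDERIV f x :> Df x"
    and hess: "\<And>x. (Df has_derivative blinfun_apply (D2f x)) (at x)"
    and cont: "continuous_on UNIV D2f"
    and "convex (epi g)" "closed (epi g)" "proper g"
    and tilt: "tilt_stable_minimizer (\<lambda>x. ereal (f x) + g x) xbar"
  obtains \<mu> where "\<mu> > 0"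
    "\<And>d. d \<in> par (subdifferential (conjugate g) (- Df xbar)) \<Longrightarrow>
      \<mu> * (norm d)\<^sup>2 \<le> D2f xbar d \<bullet> d"
proof -
  define A where "A = subdifferential (conjugate g) (- Df xbar)"
  have A: "x \<in> A \<longleftrightarrow> - Df xbar \<in> subdifferential g x" for x
    unfolding A_def using subdifferential_conjugate[OF assms(5-7)] by auto
  have xbarA: "xbar \<in> A"
    unfolding A by (rule tilt_stable_imp_critical[OF assms(5,7) grad tilt])
  have convA: "convex A" unfolding A_def by (rule convex_subdifferential)
  obtain \<rho> K where \<rho>: "\<rho> > 0" "K \<ge> 0"
    and expand: "\<And>x y. x \<in> ball xbar \<rho> \<Longrightarrow> y \<in> ball xbar \<rho> \<Longrightarrow> x \<in> A \<Longrightarrow> y \<in> A \<Longrightarrow>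
      norm (x - y) \<le> K * norm (Df x - Df y)"
    using tilt_stable_gradient_expanding[OF convf grad has_derivative_continuous[OF hess] tilt]
    unfolding A by blast
  obtain c where c: "c \<in> rel_interior A"
    using rel_interior_eq_empty[OF convA] xbarA by auto
  define p where "p s = xbar - s *\<^sub>R (xbar - c)" for s :: real
  have bound: "norm d \<le> K * norm (D2f xbar d)" if d: "d \<in> par A" for d
  proof -
    have p_bound: "norm d \<le> K * norm (D2f (p s) d)"
      if s: "0 < s" "s \<le> 1" "p s \<in> ball xbar \<rho>" for s
    proof -
      have "p s \<in> rel_interior A"
        unfolding p_def using rel_interior_convex_shrink[OF convA c xbarA] s by simp
      then obtain e where pA: "p s \<in> A" and e: "e > 0" "ball (p s) e \<inter> affine hull A \<subseteq> A"
        using mem_rel_interior_ball by metis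
      obtain e' where e': "e' > 0" "ball (p s) e' \<subseteq> ball xbar \<rho>"
        using s(3) open_contains_ball by blast
      have n: "norm d + 1 > 0" by (simp add: add_nonneg_pos)
      have aff: "p s + t *\<^sub>R d \<in> affine hull A" for t
      proof -
        have "affine hull A = (\<lambda>x. p s + x) ` span ((\<lambda>x. - p s + x) ` A)"
          using pA by (intro affine_hull_span_gen) (rule hull_inc)
        moreover have "t *\<^sub>R d \<in> span ((\<lambda>x. - p s + x) ` A)"
          using d unfolding par_eq_span[OF pA] by (simp add: span_scale)
        ultimately show ?thesis by blast
      qed
      have "norm (t *\<^sub>R d) \<le> K * norm (Df (p s + t *\<^sub>R d) - Df (p s))"
        if t: "0 < t" "t < min e e' / (norm d + 1)" for t
      proof -
        have "t * norm d \<le> t * (norm d + 1)" using t by simp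
        also have "\<dots> < min e e'" using t n by (simp add: pos_less_divide_eq)
        finally have "p s + t *\<^sub>R d \<in> ball (p s) e" "p s + t *\<^sub>R d \<in> ball (p s) e'"
          using t by (auto simp: dist_norm)
        then have "p s + t *\<^sub>R d \<in> A" "p s + t *\<^sub>R d \<in> ball xbar \<rho>"
          using aff e(2) e'(2) by blast+
        then show ?thesis using expand[of "p s + t *\<^sub>R d" "p s"] pA s(3) by simp
      qed
      then show ?thesis
        using e(1) e'(1) n
        by (intro derivative_expanding[where \<tau> = "min e e' / (norm d + 1)", OF hess \<rho>(2)])
          (auto simp del: norm_scaleR)
    qed
    have lim: "(p \<longlongrightarrow> xbar) (at_right 0)"
    proof -
      have "(p \<longlongrightarrow> xbar - 0 *\<^sub>R (xbar - c)) (at_right 0)"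
        unfolding p_def by (intro tendsto_intros)
      then show ?thesis by simp
    qed
    then have "eventually (\<lambda>s. p s \<in> ball xbar \<rho>) (at_right 0)"
      using \<rho>(1) by (intro topological_tendstoD) auto
    moreover have "eventually (\<lambda>s::real. s \<in> {0<..<1}) (at_right 0)"
      by (intro eventually_at_rightI[of 0 1]) auto
    ultimately have "eventually (\<lambda>s. norm d \<le> K * norm (D2f (p s) d)) (at_right 0)"
      by eventually_elim (rule p_bound, auto)
    moreover have "((\<lambda>s. D2f (p s)) \<longlongrightarrow> D2f xbar) (at_right 0)"
      using cont lim by (auto simp: continuous_on_eq_continuous_at intro: isCont_tendsto_compose)
    then have "((\<lambda>s. K * norm (D2f (p s) d)) \<longlongrightarrow> K * norm (D2f xbar d)) (at_right 0)"
      by (intro tendsto_intros)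
    ultimately show ?thesis
      by (intro tendsto_lowerbound[of _ _ "at_right 0"]) auto
  qed
  define M where "M = K\<^sup>2 * (norm (D2f xbar) + 1) + 1"
  have M: "M > 0" unfolding M_def by (intro add_nonneg_pos mult_nonneg_nonneg) auto
  have "1 / M * (norm d)\<^sup>2 \<le> D2f xbar d \<bullet> d" if "d \<in> par A" for d
  proof -
    have psd: "0 \<le> D2f xbar w \<bullet> w" for w by (rule convex_hessian_nonneg[OF convf grad hess])
    have "(norm d)\<^sup>2 \<le> (K * norm (D2f xbar d))\<^sup>2"
      using bound[OF that] by (intro power_mono) auto
    also have "\<dots> = K\<^sup>2 * (norm (D2f xbar d))\<^sup>2" by (simp add: power_mult_distrib)
    also have "\<dots> \<le> K\<^sup>2 * ((norm (D2f xbar) + 1) * (D2f xbar d \<bullet> d))"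
      using psd_norm_le[OF hessian_symmetric[OF grad hess cont] psd]
      by (intro mult_left_mono) auto
    also have "\<dots> \<le> M * (D2f xbar d \<bullet> d)"
      using psd[of d] by (simp add: M_def algebra_simps)
    finally show ?thesis using M by (simp add: field_simps)
  qed
  then show thesis using that[of "1 / M"] M unfolding A_def by simp
qed

section \<open>Local quadratic error estimate for one iteration\<close>

text \<open>The three properties of the effective subspace used by the Newton step. The orthogonality
  follows from monotonicity applied twice, both \<open>z\<close> and \<open>zbar\<close> being subgradients at every point
  of the subdifferential of the conjugate at \<open>z\<close>, and at \<open>xbar\<close>.\<close>

lemma par_subdifferential_conjugate_facts:
  fixes g :: "'a::euclidean_space \<Rightarrow> ereal"
  assumes "convex (epi g)" "closed (epi g)" "proper g"
    and y: "z \<in> subdifferential g y" and x: "z \<in> subdifferential g xbar"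
    and sub: "subdifferential (conjugate g) z \<subseteq> subdifferential (conjugate g) zbar"
  shows "y - xbar \<in> par (subdifferential (conjugate g) z)"
    and "par (subdifferential (conjugate g) z) \<subseteq> par (subdifferential (conjugate g) zbar)"
    and "e \<in> par (subdifferential (conjugate g) z) \<Longrightarrow> z \<bullet> e = zbar \<bullet> e"
proof -
  let ?A = "subdifferential (conjugate g)"
  have A: "x \<in> ?A z \<longleftrightarrow> z \<in> subdifferential g x" for x z
    using subdifferential_conjugate[OF assms(1-3)] by auto
  have xz: "xbar \<in> ?A z" "xbar \<in> ?A zbar" using x A sub by blast+
  note par = xz[THEN par_eq_span]
  show "y - xbar \<in> par (?A z)"
    unfolding par using y A by (intro span_base) blast
  show "par (?A z) \<subseteq> par (?A zbar)"
    unfolding par using sub by (intro span_mono image_mono)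
  have "(z - zbar) \<bullet> (w - xbar) = 0" if "w \<in> ?A z" for w
  proof (rule antisym)
    have w: "z \<in> subdifferential g w" "zbar \<in> subdifferential g w" using that sub A by blast+
    have xb: "zbar \<in> subdifferential g xbar" using xz A by blast
    show "0 \<le> (z - zbar) \<bullet> (w - xbar)" by (rule subdifferential_monotone[OF w(1) xb])
    have "0 \<le> (z - zbar) \<bullet> (xbar - w)" by (rule subdifferential_monotone[OF x w(2)])
    then show "(z - zbar) \<bullet> (w - xbar) \<le> 0" by (simp add: inner_diff_right)
  qed
  then have "span ((\<lambda>w. w - xbar) ` ?A z) \<subseteq> {e. (z - zbar) \<bullet> e = 0}"
    by (intro span_minimal subspace_hyperplane) auto
  then show "z \<bullet> e = zbar \<bullet> e" if "e \<in> par (?A z)"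
    using that unfolding par by (auto simp: inner_diff_left)
qed

lemma gradient_linearization_error:
  fixes Df :: "'a::real_normed_vector \<Rightarrow> 'a"
  assumes hess: "\<And>x. (Df has_derivative blinfun_apply (D2f x)) (at x)"
    and lip: "K-lipschitz_on S D2f" and S: "convex S" "x \<in> S" "y \<in> S"
  shows "norm (Df x - Df y - D2f y (x - y)) \<le> K * (norm (x - y))\<^sup>2"
proof -
  have seg: "closed_segment y x \<subseteq> S" using S by (simp add: closed_segment_subset)
  have "norm (Df x - Df y - D2f y (x - y)) \<le> norm (x - y) * (K * norm (x - y))"
  proof (rule differentiable_bound_linearization[where S = "closed_segment y x"
        and f' = "\<lambda>w. blinfun_apply (D2f w)" and ?x0.0 = y])
    show "y + t *\<^sub>R (x - y) \<in> closed_segment y x" if "t \<in> {0..1}" for t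
      using that by (auto simp: in_segment algebra_simps intro!: exI[of _ t])
    show "(Df has_derivative blinfun_apply (D2f w)) (at w within closed_segment y x)" for w
      using hess by (rule has_derivative_at_withinI)
    fix w assume w: "w \<in> closed_segment y x"
    have "onorm (blinfun_apply (D2f w) - blinfun_apply (D2f y)) = norm (D2f w - D2f y)"
      by (simp add: norm_blinfun.rep_eq minus_blinfun.rep_eq fun_diff_def)
    also have "\<dots> \<le> K * norm (w - y)"
      using lipschitz_onD[OF lip, of w y] w seg S by (auto simp: dist_norm)
    also have "\<dots> \<le> K * norm (x - y)"
      using segment_bound1[OF w] lipschitz_on_nonneg[OF lip] by (intro mult_left_mono) auto
    finally show "onorm (blinfun_apply (D2f w) - blinfun_apply (D2f y)) \<le> K * norm (x - y)" .
  qed simp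
  then show ?thesis by (simp add: power2_eq_square mult_ac)
qed

lemma gradient_locally_calm:
  fixes Df :: "'a::real_normed_vector \<Rightarrow> 'a"
  assumes "(Df has_derivative blinfun_apply H) (at x)"
  obtains \<rho> where "\<rho> > 0"
    "\<And>u. norm (u - x) < \<rho> \<Longrightarrow> norm (Df u - Df x) \<le> (norm H + 1) * norm (u - x)"
proof -
  obtain \<rho> where \<rho>: "\<rho> > 0"
    "\<And>u. norm (u - x) < \<rho> \<Longrightarrow> norm (Df u - Df x - H (u - x)) \<le> 1 * norm (u - x)"
    using assms unfolding has_derivative_at_alt by (metis zero_less_one)
  have "norm (Df u - Df x) \<le> (norm H + 1) * norm (u - x)" if "norm (u - x) < \<rho>" for u
    using \<rho>(2)[OF that] norm_blinfun[of H "u - x"] norm_triangle_sub[of "Df u - Df x" "H (u - x)"]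
    by (simp add: distrib_right)
  then show thesis using that \<rho>(1) by blast
qed

text \<open>Newton's method on the subspace \<open>L\<close>: since \<open>y - xbar\<close> lies in \<open>L\<close>, the error of the next
  iterate lies in \<open>L\<close> as well, and the normal equation bounds it by the linearization error
  of the gradient.\<close>

lemma subspace_newton_error:
  fixes H :: "'a::real_inner \<Rightarrow>\<^sub>L 'a"
  assumes sym: "\<And>a b. H a \<bullet> b = a \<bullet> H b" and L: "subspace L"
    and "\<mu> > 0" and coercive: "\<And>d. d \<in> L \<Longrightarrow> \<mu> * (norm d)\<^sup>2 \<le> H d \<bullet> d"
    and yx: "y - xbar \<in> L" and orth: "\<And>e. e \<in> L \<Longrightarrow> z \<bullet> e = zbar \<bullet> e"
    and d: "d \<in> argmin_on (\<lambda>d. 1 / 2 * (blinfun_apply H d \<bullet> d) - (z + gy) \<bullet> d) L"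
  shows "\<mu> * norm (y - d - xbar) \<le> norm (- zbar - gy - H (xbar - y))"
proof -
  define e where "e = y - xbar - d"
  have "d \<in> L" using d by (simp add: argmin_on_iff)
  then have e: "e \<in> L" unfolding e_def using yx L by (simp add: subspace_diff)
  have "\<mu> * (norm e)\<^sup>2 \<le> H e \<bullet> e" by (rule coercive[OF e])
  also have "\<dots> = H (y - xbar) \<bullet> e - H d \<bullet> e"
    by (simp add: e_def blinfun.diff_right inner_diff_left)
  also have "\<dots> = H (y - xbar) \<bullet> e - (zbar + gy) \<bullet> e"
    using quadratic_argmin_normal_equation[OF sym L d e] orth[OF e] by (simp add: inner_add_left)
  also have "\<dots> = (- zbar - gy - H (xbar - y)) \<bullet> e"
    by (simp add: blinfun.diff_right inner_diff_left inner_add_left)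
  also have "\<dots> \<le> norm (- zbar - gy - H (xbar - y)) * norm e" by (rule norm_cauchy_schwarz)
  finally have "\<mu> * norm e * norm e \<le> norm (- zbar - gy - H (xbar - y)) * norm e"
    by (simp add: power2_eq_square)
  then have "\<mu> * norm e \<le> norm (- zbar - gy - H (xbar - y))"
    by (cases "e = 0") auto
  moreover have "y - d - xbar = e" by (simp add: e_def)
  ultimately show ?thesis by simp
qed

lemma fista_newton_step_quadratic:
  fixes f :: "'a::euclidean_space \<Rightarrow> real" and D2f :: "'a \<Rightarrow> 'a \<Rightarrow>\<^sub>L 'a"
  assumes grad: "\<And>x. GDERIV f x :> Df x"
    and hess: "\<And>x. (Df has_derivative blinfun_apply (D2f x)) (at x)"
    and cont: "continuous_on UNIV D2f"
    and "proper g" and poly: "polyhedron (epi g)"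
    and crit: "- Df xbar \<in> subdifferential g xbar"
    and "\<mu> > 0" and coercive: "\<And>d. d \<in> par (subdifferential (conjugate g) (- Df xbar)) \<Longrightarrow>
      \<mu> * (norm d)\<^sup>2 \<le> D2f xbar d \<bullet> d"
    and lip: "open U" "xbar \<in> U" "K-lipschitz_on U D2f"
    and "\<alpha> > 0"
  obtains \<delta> C where "\<delta> > 0" "C > 0"
    "\<And>b xp xc. 0 < b \<Longrightarrow> b \<le> 1 \<Longrightarrow> norm (xp - xbar) \<le> \<delta> \<Longrightarrow> norm (xc - xbar) \<le> \<delta> \<Longrightarrow>
      \<exists>xn. fista_newton_step Df D2f g \<alpha> b xp xc xn"
    "\<And>b xp xc xn. 0 < b \<Longrightarrow> b \<le> 1 \<Longrightarrow> norm (xp - xbar) \<le> \<delta> \<Longrightarrow> norm (xc - xbar) \<le> \<delta> \<Longrightarrow>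
      fista_newton_step Df D2f g \<alpha> b xp xc xn \<Longrightarrow>
      norm (xn - xbar) \<le> C * (max (norm (xc - xbar)) (norm (xp - xbar)))\<^sup>2"
proof -
  note conv = polyhedron_imp_convex[OF poly] and clos = polyhedron_imp_closed[OF poly]
  let ?A = "subdifferential (conjugate g)"
  have sym: "D2f y a \<bullet> b = a \<bullet> D2f y b" for y a b by (rule hessian_symmetric[OF grad hess cont])
  define \<theta> where "\<theta> = norm (D2f xbar) + 1"
  obtain \<rho>1 where \<rho>1: "\<rho>1 > 0"
    "\<And>u. norm (u - xbar) < \<rho>1 \<Longrightarrow> norm (Df u - Df xbar) \<le> \<theta> * norm (u - xbar)"
    unfolding \<theta>_def using gradient_locally_calm[OF hess] by blast
  obtain \<rho>2 where \<rho>2: "\<rho>2 > 0" "ball xbar \<rho>2 \<subseteq> U" using lip open_contains_ball by blast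
  obtain \<rho>3 where \<rho>3: "\<rho>3 > 0" "\<And>y. norm (y - xbar) < \<rho>3 \<Longrightarrow> norm (D2f y - D2f xbar) < \<mu> / 2"
    using cont \<open>\<mu> > 0\<close>
    unfolding continuous_on_eq_continuous_at[OF open_UNIV] continuous_at_eps_delta dist_norm
    by (metis UNIV_I half_gt_zero)
  obtain \<rho>4 where \<rho>4: "\<rho>4 > 0" "\<And>z. norm (z - (- Df xbar)) < \<rho>4 \<Longrightarrow> ?A z \<subseteq> ?A (- Df xbar)"
    using polyhedral_subdifferential_conjugate_upper_local[OF poly \<open>proper g\<close>] by metis
  obtain \<rho>5 where \<rho>5: "\<rho>5 > 0"
    "\<And>y z. norm (y - xbar) < \<rho>5 \<Longrightarrow> z \<in> subdifferential g y \<Longrightarrow> z \<in> subdifferential g xbar"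
    using polyhedral_subgradient_extends_local[OF poly \<open>proper g\<close>] by metis
  have "K \<ge> 0" using lip(3) by (rule lipschitz_on_nonneg)
  have "\<theta> > 0" by (simp add: \<theta>_def add_nonneg_pos)
  define \<kappa> where "\<kappa> = 1 + \<alpha> * \<theta>"
  define \<kappa>' where "\<kappa>' = (1 + \<kappa>) / \<alpha> + \<theta>"
  have \<kappa>: "\<kappa> > 0" "\<kappa>' > 0"
    using \<open>\<theta> > 0\<close> \<open>\<alpha> > 0\<close> by (auto simp: \<kappa>_def \<kappa>'_def intro!: add_pos_pos divide_pos_pos)
  define \<eta> where "\<eta> = Min {\<rho>1, \<rho>2, \<rho>3, \<rho>4, \<rho>5}"
  have \<eta>: "\<eta> > 0" "\<eta> \<le> \<rho>1" "\<eta> \<le> \<rho>2" "\<eta> \<le> \<rho>3" "\<eta> \<le> \<rho>4" "\<eta> \<le> \<rho>5"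
    using \<rho>1 \<rho>2 \<rho>3 \<rho>4 \<rho>5 by (auto simp: \<eta>_def)
  \<comment> \<open>\<open>norm (u - xbar) \<le> 3 * \<delta>\<close> by extrapolation, so that \<open>u\<close>, \<open>y\<close> and \<open>z\<close> have errors at most
    \<open>\<eta> / 2\<close>\<close>
  define \<delta> where "\<delta> = \<eta> / (6 * (1 + \<kappa> + \<kappa>'))"
  \<comment> \<open>half of \<open>\<mu>\<close> remains at \<open>y\<close>, hence \<open>2 * (3 * \<kappa>)\<^sup>2\<close>; the summand 1 makes \<open>C\<close> positive when \<open>K = 0\<close>\<close>
  define C where "C = 18 * K * \<kappa>\<^sup>2 / \<mu> + 1"
  have pos: "1 + \<kappa> + \<kappa>' > 0" using \<kappa> by simp
  have "\<delta> > 0" using \<eta>(1) pos by (simp add: \<delta>_def)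
  have "C > 0" using \<open>K \<ge> 0\<close> \<open>\<mu> > 0\<close> by (simp add: C_def add_nonneg_pos)

  \<comment> \<open>the part of an iteration that precedes the choice of the Newton direction\<close>
  have step: "norm (y - xbar) \<le> \<kappa> * (3 * max (norm (xc - xbar)) (norm (xp - xbar)))
      \<and> norm (y - xbar) < \<rho>2
      \<and> y - xbar \<in> par (?A z)
      \<and> (\<forall>d\<in>par (?A z). \<mu> / 2 * (norm d)\<^sup>2 \<le> D2f y d \<bullet> d)
      \<and> (\<forall>e\<in>par (?A z). z \<bullet> e = - Df xbar \<bullet> e)"
    if b: "0 < b" "b \<le> 1" and near: "norm (xp - xbar) \<le> \<delta>" "norm (xc - xbar) \<le> \<delta>"
      and u: "u = xc + b *\<^sub>R (xc - xp)" and y: "y \<in> prox \<alpha> g (u - \<alpha> *\<^sub>R Df u)"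
      and z: "z = (1 / \<alpha>) *\<^sub>R (u - y) - Df u"
    for b xp xc u y z
  proof -
    define p where "p = max (norm (xc - xbar)) (norm (xp - xbar))"
    have p: "p \<le> \<delta>" using near by (simp add: p_def)
    have "u - xbar = (xc - xbar) + b *\<^sub>R ((xc - xbar) - (xp - xbar))"
      by (simp add: u algebra_simps)
    then have "norm (u - xbar) \<le> norm (xc - xbar) + b * norm ((xc - xbar) - (xp - xbar))"
      using b by (metis abs_of_pos norm_scaleR norm_triangle_ineq)
    also have "\<dots> \<le> norm (xc - xbar) + 1 * (norm (xc - xbar) + norm (xp - xbar))"
      using b by (intro add_left_mono mult_mono norm_triangle_ineq4) auto
    also have "\<dots> \<le> 3 * p" by (simp add: p_def)
    finally have ux: "norm (u - xbar) \<le> 3 * p" .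
    have "(1 + \<kappa> + \<kappa>') * norm (u - xbar) \<le> (1 + \<kappa> + \<kappa>') * (3 * \<delta>)"
      using ux p pos by (intro mult_left_mono) auto
    also have "\<dots> = \<eta> / 2"
      using nonzero_mult_divide_mult_cancel_left[of "1 + \<kappa> + \<kappa>'" \<eta> 6] pos
      unfolding \<delta>_def by (simp only: times_divide_eq_right mult_ac) linarith
    finally have "norm (u - xbar) + \<kappa> * norm (u - xbar) + \<kappa>' * norm (u - xbar) \<le> \<eta> / 2"
      by (simp add: distrib_right)
    moreover have "0 \<le> \<kappa> * norm (u - xbar)" "0 \<le> \<kappa>' * norm (u - xbar)" using \<kappa> by auto
    ultimately have small: "norm (u - xbar) < \<eta>" "\<kappa> * norm (u - xbar) < \<eta>"
      "\<kappa>' * norm (u - xbar) < \<eta>"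
      using \<eta>(1) norm_ge_zero[of "u - xbar"] by linarith+
    have Du: "norm (Df u - Df xbar) \<le> \<theta> * norm (u - xbar)" using small \<eta> \<rho>1 by auto
    have zy: "z \<in> subdifferential g y"
    proof -
      have "(1 / \<alpha>) *\<^sub>R (u - \<alpha> *\<^sub>R Df u - y) = z"
        using \<open>\<alpha> > 0\<close> by (simp add: z algebra_simps)
      then show ?thesis
        using prox_imp_subgradient[OF conv \<open>proper g\<close> \<open>\<alpha> > 0\<close> y] by simp
    qed
    \<comment> \<open>\<open>xbar\<close> is a fixed point of the proximal gradient map\<close>
    have yx: "norm (y - xbar) \<le> \<kappa> * norm (u - xbar)"
    proof -
      have "norm (y - xbar) \<le> norm ((y + \<alpha> *\<^sub>R z) - (xbar + \<alpha> *\<^sub>R (- Df xbar)))"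
        using \<open>\<alpha> > 0\<close> by (intro resolvent_nonexpansive[OF zy crit]) simp
      also have "(y + \<alpha> *\<^sub>R z) - (xbar + \<alpha> *\<^sub>R (- Df xbar))
          = (u - xbar) - \<alpha> *\<^sub>R (Df u - Df xbar)"
        using \<open>\<alpha> > 0\<close> by (simp add: z algebra_simps)
      also have "norm \<dots> \<le> norm (u - xbar) + \<alpha> * norm (Df u - Df xbar)"
        using norm_triangle_ineq4[of "u - xbar" "\<alpha> *\<^sub>R (Df u - Df xbar)"] \<open>\<alpha> > 0\<close> by simp
      also have "\<dots> \<le> norm (u - xbar) + \<alpha> * (\<theta> * norm (u - xbar))"
        using Du \<open>\<alpha> > 0\<close> by simp
      finally show ?thesis by (simp add: \<kappa>_def algebra_simps)
    qed
    have zz: "norm (z - (- Df xbar)) \<le> \<kappa>' * norm (u - xbar)"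
    proof -
      have "z - (- Df xbar) = (1 / \<alpha>) *\<^sub>R ((u - xbar) - (y - xbar)) - (Df u - Df xbar)"
        by (simp add: z)
      also have "norm \<dots> \<le> norm ((1 / \<alpha>) *\<^sub>R ((u - xbar) - (y - xbar))) + norm (Df u - Df xbar)"
        by (rule norm_triangle_ineq4)
      also have "norm ((1 / \<alpha>) *\<^sub>R ((u - xbar) - (y - xbar)))
          = norm ((u - xbar) - (y - xbar)) / \<alpha>" using \<open>\<alpha> > 0\<close> by simp
      also have "norm ((u - xbar) - (y - xbar)) \<le> (1 + \<kappa>) * norm (u - xbar)"
        using norm_triangle_ineq4[of "u - xbar" "y - xbar"] yx by (simp add: distrib_right)
      finally show ?thesis using Du \<open>\<alpha> > 0\<close>
        by (simp add: \<kappa>'_def distrib_right divide_right_mono)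
    qed
    have zx: "z \<in> subdifferential g xbar" using \<rho>5(2)[OF _ zy] yx small \<eta> by linarith
    have sub: "?A z \<subseteq> ?A (- Df xbar)" using zz small \<eta> by (intro \<rho>4(2)) linarith
    note L = par_subdifferential_conjugate_facts[OF conv clos \<open>proper g\<close> zy zx sub]
    have "\<mu> / 2 * (norm d)\<^sup>2 \<le> D2f y d \<bullet> d" if "d \<in> par (?A z)" for d
    proof -
      have "norm (D2f y - D2f xbar) \<le> \<mu> / 2" using \<rho>3(2)[of y] yx small \<eta> by linarith
      then have "norm ((D2f y - D2f xbar) d) * norm d \<le> (\<mu> / 2 * norm d) * norm d"
        by (intro mult_right_mono order_trans[OF norm_blinfun]) auto
      moreover have "\<bar>(D2f y - D2f xbar) d \<bullet> d\<bar> \<le> norm ((D2f y - D2f xbar) d) * norm d"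
        by (rule Cauchy_Schwarz_ineq2)
      moreover have "(D2f y - D2f xbar) d \<bullet> d = D2f y d \<bullet> d - D2f xbar d \<bullet> d"
        by (simp add: blinfun.diff_left inner_diff_left)
      moreover have "\<mu> * (norm d)\<^sup>2 \<le> D2f xbar d \<bullet> d" using coercive L(2) that by blast
      ultimately show ?thesis by (simp add: power2_eq_square)
    qed
    moreover have "\<kappa> * norm (u - xbar) \<le> \<kappa> * (3 * p)" using ux \<kappa> by simp
    then have "norm (y - xbar) \<le> \<kappa> * (3 * p)" using yx by simp
    moreover have "norm (y - xbar) < \<rho>2" using yx small \<eta> by linarith
    ultimately show ?thesis using L(1,3) unfolding p_def by blast
  qed
  show thesis
  proof (rule that[OF \<open>\<delta> > 0\<close> \<open>C > 0\<close>])
    fix b :: real and xp xc :: 'a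
    assume b: "0 < b" "b \<le> 1" and near: "norm (xp - xbar) \<le> \<delta>" "norm (xc - xbar) \<le> \<delta>"
    define u where "u = xc + b *\<^sub>R (xc - xp)"
    obtain y where y: "y \<in> prox \<alpha> g (u - \<alpha> *\<^sub>R Df u)"
      using prox_nonempty[OF clos crit \<open>\<alpha> > 0\<close>] by blast
    define z where "z = (1 / \<alpha>) *\<^sub>R (u - y) - Df u"
    have "\<And>d. d \<in> par (?A z) \<Longrightarrow> \<mu> / 2 * (norm d)\<^sup>2 \<le> D2f y d \<bullet> d"
      using step[OF b near u_def y z_def] by blast
    then obtain d where
      "d \<in> argmin_on (\<lambda>d. 1 / 2 * (blinfun_apply (D2f y) d \<bullet> d) - (z + Df y) \<bullet> d) (par (?A z))"
      using quadratic_argmin_exists[of "par (?A z)" "\<mu> / 2" "D2f y" "z + Df y"] \<open>\<mu> > 0\<close>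
      by (auto simp: par_def)
    then show "\<exists>xn. fista_newton_step Df D2f g \<alpha> b xp xc xn"
      unfolding fista_newton_step_def using u_def y z_def by blast
  next
    fix b :: real and xp xc xn :: 'a
    assume b: "0 < b" "b \<le> 1" and near: "norm (xp - xbar) \<le> \<delta>" "norm (xc - xbar) \<le> \<delta>"
      and "fista_newton_step Df D2f g \<alpha> b xp xc xn"
    then obtain u y z d where u: "u = xc + b *\<^sub>R (xc - xp)"
      and y: "y \<in> prox \<alpha> g (u - \<alpha> *\<^sub>R Df u)" and z: "z = (1 / \<alpha>) *\<^sub>R (u - y) - Df u"
      and d: "d \<in> argmin_on (\<lambda>d. 1 / 2 * (blinfun_apply (D2f y) d \<bullet> d) - (z + Df y) \<bullet> d)
        (par (?A z))"
      and xn: "xn = y - d"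
      unfolding fista_newton_step_def by blast
    define p where "p = max (norm (xc - xbar)) (norm (xp - xbar))"
    note s = step[OF b near u y z, folded p_def]
    have "\<mu> / 2 * norm (xn - xbar) \<le> norm (- (- Df xbar) - Df y - D2f y (xbar - y))"
      unfolding xn
      by (rule subspace_newton_error[OF sym _ _ _ _ _ d]) (use s \<open>\<mu> > 0\<close> in \<open>auto simp: par_def\<close>)
    also have "\<dots> \<le> K * (norm (xbar - y))\<^sup>2"
      using gradient_linearization_error[OF hess lipschitz_on_subset[OF lip(3) \<rho>2(2)] convex_ball,
          of xbar y] s \<rho>2(1) by (simp add: dist_norm norm_minus_commute)
    also have "\<dots> \<le> K * (\<kappa> * (3 * p))\<^sup>2"
      using s \<open>K \<ge> 0\<close> by (intro mult_left_mono power_mono) (auto simp: norm_minus_commute)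
    finally have "norm (xn - xbar) \<le> 18 * K * \<kappa>\<^sup>2 / \<mu> * p\<^sup>2"
      using \<open>\<mu> > 0\<close> by (simp add: field_simps power_mult_distrib)
    also have "\<dots> \<le> C * p\<^sup>2" by (simp add: C_def distrib_right)
    finally show "norm (xn - xbar) \<le> C * (max (norm (xc - xbar)) (norm (xp - xbar)))\<^sup>2"
      by (simp add: p_def)
  qed
qed

section \<open>Convergence of the iteration\<close>

lemma prev_simps [simp]: "prev x 0 = x 0" "prev x (Suc k) = x k"
  by (simp_all add: prev_def)

text \<open>Each step depends on two predecessors, so dependent choice is applied to the pairs of
  consecutive iterates.\<close>

lemma fista_newton_sequence_exists:
  assumes step: "\<And>k xp xc. norm (xp - xbar) \<le> \<epsilon> \<Longrightarrow> norm (xc - xbar) \<le> \<epsilon> \<Longrightarrow>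
      \<exists>xn. fista_newton_step Df D2f g \<alpha> (\<beta> k) xp xc xn \<and> norm (xn - xbar) \<le> \<epsilon>"
    and x0: "norm (x0 - xbar) \<le> \<epsilon>"
  shows "\<exists>x. fista_newton_sequence Df D2f g \<alpha> \<beta> x0 x"
proof -
  let ?P = "\<lambda>(n::nat) s. norm (fst s - xbar) \<le> \<epsilon> \<and> norm (snd s - xbar) \<le> \<epsilon> \<and>
    (n = 0 \<longrightarrow> s = (x0, x0))"
  let ?Q = "\<lambda>(n::nat) s s'. fst s' = snd s \<and> fista_newton_step Df D2f g \<alpha> (\<beta> n) (fst s) (snd s) (snd s')"
  have "\<exists>s. \<forall>n. ?P n (s n) \<and> ?Q n (s n) (s (Suc n))"
  proof (rule dependent_nat_choice)
    show "\<exists>s. ?P 0 s" using x0 by auto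
    fix s n assume "?P n s"
    then obtain xn where "fista_newton_step Df D2f g \<alpha> (\<beta> n) (fst s) (snd s) xn"
      "norm (xn - xbar) \<le> \<epsilon>" using step by blast
    then show "\<exists>s'. ?P (Suc n) s' \<and> ?Q n s s'"
      using \<open>?P n s\<close> by (intro exI[of _ "(snd s, xn)"]) auto
  qed
  then obtain s where s: "\<And>n. ?P n (s n)" "\<And>n. ?Q n (s n) (s (Suc n))" by blast
  have "prev (\<lambda>k. snd (s k)) k = fst (s k)" for k
    using s by (cases k) auto
  then have "fista_newton_sequence Df D2f g \<alpha> \<beta> x0 (\<lambda>k. snd (s k))"
    unfolding fista_newton_sequence_def using s by auto
  then show ?thesis by blast
qed

theorem corollary3p9:
  fixes f :: "'a::euclidean_space \<Rightarrow> real"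
    and Df :: "'a \<Rightarrow> 'a"
    and D2f :: "'a \<Rightarrow> 'a \<Rightarrow>\<^sub>L 'a"
    and g :: "'a \<Rightarrow> ereal"
    and xbar :: 'a
    and \<alpha> :: real
    and \<beta> :: "nat \<Rightarrow> real"
  assumes "convex_on UNIV f"
    and "\<And>x. GDERIV f x :> Df x"
    and "\<And>x. (Df has_derivative blinfun_apply (D2f x)) (at x)"
    and "continuous_on UNIV D2f"
    and "proper g"
    and "convex_polyhedral g"
    and "tilt_stable_minimizer (\<lambda>x. ereal (f x) + g x) xbar"
    and "\<exists>U K. open U \<and> xbar \<in> U \<and> K-lipschitz_on U D2f"
    and "\<alpha> > 0"
    and "\<And>k. 0 < \<beta> k \<and> \<beta> k \<le> 1"
    and "\<exists>b>0. \<forall>k. b \<le> \<beta> k"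
  shows "\<exists>C>0. \<exists>\<epsilon>0>0. \<forall>\<epsilon>. 0 < \<epsilon> \<and> \<epsilon> \<le> \<epsilon>0 \<longrightarrow>
    (\<forall>x0. norm (x0 - xbar) \<le> \<epsilon> \<longrightarrow>
      (\<exists>x. fista_newton_sequence Df D2f g \<alpha> \<beta> x0 x) \<and>
      (\<forall>x. fista_newton_sequence Df D2f g \<alpha> \<beta> x0 x \<longrightarrow>
        pair_error xbar x 0 \<le> \<epsilon> \<and> pair_error xbar x 1 \<le> \<epsilon> \<and>
        (\<forall>k. pair_error xbar x (k + 2) \<le> C * (pair_error xbar x k)\<^sup>2)))"
proof -
  have poly: "polyhedron (epi g)" using assms(6) by (simp add: convex_polyhedral_def)
  note conv = polyhedron_imp_convex[OF poly] and clos = polyhedron_imp_closed[OF poly]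
  obtain U K where lip: "open U" "xbar \<in> U" "K-lipschitz_on U D2f" using assms(8) by blast
  have crit: "- Df xbar \<in> subdifferential g xbar"
    by (rule tilt_stable_imp_critical[OF conv assms(5,2,7)])
  obtain \<mu> where \<mu>: "\<mu> > 0" "\<And>d. d \<in> par (subdifferential (conjugate g) (- Df xbar)) \<Longrightarrow>
      \<mu> * (norm d)\<^sup>2 \<le> D2f xbar d \<bullet> d"
    using tilt_stable_hessian_coercive[OF assms(1-4) conv clos assms(5,7)] by blast
  obtain \<delta> C where "\<delta> > 0" "C > 0"
    and ex: "\<And>b xp xc. 0 < b \<Longrightarrow> b \<le> 1 \<Longrightarrow> norm (xp - xbar) \<le> \<delta> \<Longrightarrow> norm (xc - xbar) \<le> \<delta> \<Longrightarrow>
      \<exists>xn. fista_newton_step Df D2f g \<alpha> b xp xc xn"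
    and quad: "\<And>b xp xc xn. 0 < b \<Longrightarrow> b \<le> 1 \<Longrightarrow> norm (xp - xbar) \<le> \<delta> \<Longrightarrow>
      norm (xc - xbar) \<le> \<delta> \<Longrightarrow> fista_newton_step Df D2f g \<alpha> b xp xc xn \<Longrightarrow>
      norm (xn - xbar) \<le> C * (max (norm (xc - xbar)) (norm (xp - xbar)))\<^sup>2"
    using fista_newton_step_quadratic[OF assms(2-5) poly crit \<mu> lip assms(9)] by metis
  define \<epsilon>0 where "\<epsilon>0 = min \<delta> (1 / C)"
  have "\<epsilon>0 > 0" using \<open>\<delta> > 0\<close> \<open>C > 0\<close> by (simp add: \<epsilon>0_def)
  \<comment> \<open>\<open>C * p \<le> 1\<close> turns the quadratic estimate into \<open>C * p\<^sup>2 \<le> p\<close>\<close>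
  have contract: "norm (xn - xbar) \<le> max (norm (xc - xbar)) (norm (xp - xbar))"
    if "norm (xp - xbar) \<le> \<epsilon>0" "norm (xc - xbar) \<le> \<epsilon>0"
      "fista_newton_step Df D2f g \<alpha> (\<beta> k) xp xc xn" for k xp xc xn
  proof -
    define p where "p = max (norm (xc - xbar)) (norm (xp - xbar))"
    have p: "0 \<le> p" "p \<le> 1 / C" using that by (auto simp: p_def \<epsilon>0_def le_max_iff_disj)
    have "norm (xn - xbar) \<le> C * p\<^sup>2"
      unfolding p_def using that assms(10) by (intro quad) (auto simp: \<epsilon>0_def)
    also have "\<dots> = (C * p) * p" by (simp add: power2_eq_square)
    also have "\<dots> \<le> 1 * p" using p \<open>C > 0\<close> by (intro mult_right_mono) (auto simp: field_simps)
    finally show ?thesis by (simp add: p_def)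
  qed
  show ?thesis
  proof (rule exI[of _ C], rule conjI[OF \<open>C > 0\<close>], rule exI[of _ \<epsilon>0], rule conjI[OF \<open>\<epsilon>0 > 0\<close>],
      intro allI impI conjI; (elim conjE)?)
    fix \<epsilon> x0 assume \<epsilon>: "0 < \<epsilon>" "\<epsilon> \<le> \<epsilon>0" and x0: "norm (x0 - xbar) \<le> \<epsilon>"
    show "\<exists>x. fista_newton_sequence Df D2f g \<alpha> \<beta> x0 x"
    proof (rule fista_newton_sequence_exists[OF _ x0])
      fix k xp xc assume near: "norm (xp - xbar) \<le> \<epsilon>" "norm (xc - xbar) \<le> \<epsilon>"
      then obtain xn where xn: "fista_newton_step Df D2f g \<alpha> (\<beta> k) xp xc xn"
        using ex[of "\<beta> k" xp xc] assms(10)[of k] \<epsilon> by (auto simp: \<epsilon>0_def)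
      then show "\<exists>xn. fista_newton_step Df D2f g \<alpha> (\<beta> k) xp xc xn \<and> norm (xn - xbar) \<le> \<epsilon>"
        using contract[OF _ _ xn] near \<epsilon> by fastforce
    qed
    fix x assume x: "fista_newton_sequence Df D2f g \<alpha> \<beta> x0 x"
    let ?p = "pair_error xbar x"
    have stp: "fista_newton_step Df D2f g \<alpha> (\<beta> k) (prev x k) (x k) (x (Suc k))" for k
      using x by (simp add: fista_newton_sequence_def)
    show p0: "?p 0 \<le> \<epsilon>"
      using x x0 by (simp add: pair_error_def fista_newton_sequence_def)
    have le: "norm (prev x k - xbar) \<le> ?p k" "norm (x k - xbar) \<le> ?p k" for k
      by (auto simp: pair_error_def)
    have dec: "?p (Suc k) \<le> ?p k" if "?p k \<le> \<epsilon>0" for k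
      using contract[OF _ _ stp, of k] le[of k] that by (simp add: pair_error_def)
    have small: "?p k \<le> \<epsilon>" for k
    proof (induction k)
      case (Suc k)
      then show ?case using dec[of k] \<epsilon> by linarith
    qed (rule p0)
    show "?p 1 \<le> \<epsilon>" by (rule small)
    have sq: "norm (x (Suc k) - xbar) \<le> C * (?p k)\<^sup>2" for k
      unfolding pair_error_def
      using le[of k] small[of k] \<epsilon> assms(10)[of k]
      by (intro quad[OF _ _ _ _ stp]) (auto simp: \<epsilon>0_def)
    fix k
    have "0 \<le> ?p (Suc k)" by (simp add: pair_error_def le_max_iff_disj)
    then have "C * (?p (Suc k))\<^sup>2 \<le> C * (?p k)\<^sup>2"
      using dec[of k] small[of k] \<epsilon> \<open>C > 0\<close> by (intro mult_left_mono power_mono) auto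
    then show "?p (k + 2) \<le> C * (?p k)\<^sup>2"
      using sq[of k] sq[of "Suc k"] by (simp add: pair_error_def[of xbar x "Suc (Suc k)"])
  qed
qed

end
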